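(* Let $v \in L^{\infty}(\mathbb{R})$ be non-negative and such that $v(-x)=v(x)$ for all $x$. Assume in addition that $v$ is monotonically increasing on $(-\infty,0)$ (and thus monotonically decreasing on $(0,\infty)$). Then $$\Gamma_v(L) \leq \frac{3\pi^2}{L^2}$$ for all $L>0$.
   Context: For a bounded non-negative potential $v:\mathbb{R}\to\mathbb{R}_{\geq 0}$ and $L>0$, let $h^D_L = -\frac{\mathrm{d}^2}{\mathrm{d}x^2}+v(x)$ be the self-adjoint Schrödinger operator on $L^2((-L/2,+L/2))$ with Dirichlet boundary conditions at $x=\pm L/2$. It has purely discrete spectrum; its eigenvalues, counted with multiplicity, are $\varepsilon_0(L) < \varepsilon_1(L) \leq \dots$. The spectral gap is $\Gamma_v(L) := \varepsilon_1(L)-\varepsilon_0(L)$. Monotonically increasing/decreasing is understood in the non-strict sense. *)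

theory Defs
  imports "HOL-Analysis.Analysis" "HOL-Library.Function_Algebras"
begin

text \<open>
  An element of the Sobolev space \<open>H\<^sup>2\<close> of a bounded interval has a unique continuously differentiable
  representative, whose derivative is absolutely continuous. We work with this representative
  instead of equivalence classes, and with absolute continuity in the form of the fundamental
  theorem of calculus for the Lebesgue integral.
\<close>

definition has_ac_derivative_on ::
  "(real \<Rightarrow> complex) \<Rightarrow> (real \<Rightarrow> complex) \<Rightarrow> real \<Rightarrow> real \<Rightarrow> bool" where
  "has_ac_derivative_on f g a b \<longleftrightarrow>
     g absolutely_integrable_on {a..b} \<and> (\<forall>x\<in>{a..b}. f x = f a + integral {a..x} g)"

definition square_integrable_on :: "(real \<Rightarrow> complex) \<Rightarrow> real set \<Rightarrow> bool" where
  "square_integrable_on f S \<longleftrightarrow>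
     f \<in> borel_measurable (lebesgue_on S) \<and> integrable (lebesgue_on S) (\<lambda>x. (cmod (f x))\<^sup>2)"

text \<open>
  The graph of \<open>-d\<^sup>2/dx\<^sup>2 + v\<close> on \<open>L\<^sup>2((-L/2, L/2))\<close> with domain
  \<open>H\<^sup>2((-L/2, L/2)) \<inter> H\<^sup>1\<^sub>0((-L/2, L/2))\<close>, for bounded \<open>v\<close>. The image \<open>g\<close> is determined
  only almost everywhere. The condition that \<open>f\<close> is zero outside the open interval contains the
  Dirichlet boundary conditions, and makes \<open>f\<close>, as a function on the whole real line, the unique
  representative of its class.
\<close>

definition dirichlet_schroedinger ::
  "(real \<Rightarrow> real) \<Rightarrow> real \<Rightarrow> (real \<Rightarrow> complex) \<Rightarrow> (real \<Rightarrow> complex) \<Rightarrow> bool" where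
  "dirichlet_schroedinger v L f g \<longleftrightarrow>
     (\<forall>x. x \<notin> {-L/2<..<L/2} \<longrightarrow> f x = 0) \<and>
     (\<exists>f' f''. has_ac_derivative_on f f' (-L/2) (L/2) \<and>
               has_ac_derivative_on f' f'' (-L/2) (L/2) \<and>
               square_integrable_on f'' {-L/2<..<L/2} \<and>
               square_integrable_on g {-L/2<..<L/2} \<and>
               (AE x in lebesgue_on {-L/2<..<L/2}. g x = - f'' x + of_real (v x) * f x))"

global_interpretation cfun: vector_space "\<lambda>(c::complex) (f::real \<Rightarrow> complex) x. c * f x"
  by unfold_locales (auto simp: algebra_simps fun_eq_iff)

definition eigenspace :: "(real \<Rightarrow> real) \<Rightarrow> real \<Rightarrow> real \<Rightarrow> (real \<Rightarrow> complex) set" where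
  "eigenspace v L E = {f. dirichlet_schroedinger v L f (\<lambda>x. of_real E * f x)}"

definition multiplicity_of :: "(real \<Rightarrow> real) \<Rightarrow> real \<Rightarrow> real \<Rightarrow> nat" where
  "multiplicity_of v L E = cfun.dim (eigenspace v L E)"

text \<open>
  The \<open>n\<close>-th eigenvalue, counted from \<open>0\<close>, with multiplicity and in increasing order: the
  smallest \<open>E\<close> such that more than \<open>n\<close> eigenvalues, counted with multiplicity, are at most \<open>E\<close>.
  (Numbers that are not eigenvalues have multiplicity \<open>0\<close>; eigenspaces are finite-dimensional.)
  Because the spectrum is discrete, the infimum is attained.
\<close>

definition eigenvalue :: "(real \<Rightarrow> real) \<Rightarrow> real \<Rightarrow> nat \<Rightarrow> real" where
  "eigenvalue v L n =
     Inf {E. \<exists>F. finite F \<and> F \<subseteq> {..E} \<and> n < (\<Sum>\<mu>\<in>F. multiplicity_of v L \<mu>)}"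

definition spectral_gap :: "(real \<Rightarrow> real) \<Rightarrow> real \<Rightarrow> real" where
  "spectral_gap v L = eigenvalue v L 1 - eigenvalue v L 0"

end

theory Submission
  imports Defs
begin

text \<open>
  By symmetry the ground state and the first excited state are the lowest even and the lowest odd
  eigenfunction, which are found by shooting from \<open>0\<close> on the half interval \<open>[0, l]\<close> with \<open>l = L/2\<close>: the
  energy \<open>E\<^sub>0\<close> (\<open>E\<^sub>1\<close>) is the supremum of those \<open>E\<close> for which the solution with data \<open>(1, 0)\<close> (with data
  \<open>(0, 1)\<close>) is positive on \<open>(0, l]\<close>. Let \<open>u\<close> be the ground state and \<open>\<kappa> = \<pi>/L\<close>. The odd test function
  \<open>sin(\<kappa>x) u(x)\<close> gives \<open>(E\<^sub>1 - E\<^sub>0) \<integral> sin\<^sup>2 u\<^sup>2 \<le> \<kappa>\<^sup>2 \<integral> cos\<^sup>2 u\<^sup>2\<close>. As \<open>v\<close> decreases on \<open>(0, l)\<close>, the quotient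
  \<open>u / cos(\<kappa>x)\<close> increases there, and integrating the derivative of \<open>sin cos\<^sup>3 (u / cos)\<^sup>2\<close> shows
  \<open>\<integral> cos\<^sup>2 u\<^sup>2 \<le> 3 \<integral> sin\<^sup>2 u\<^sup>2\<close>. All integrations are replaced by the monotonicity of a continuous function whose
  derivative is nonnegative off a countable set, which is enough because a monotone \<open>v\<close> has only
  countably many discontinuities.
\<close>

section \<open>Continuous functions differentiable off a countable set\<close>

text \<open>If \<open>F b < F a\<close>, adding a small slope keeps the drop and makes every
  derivative off \<open>N\<close> positive. Uncountably many levels lie in between, so one of them
  is missed by the image of \<open>N\<close>. At the last point at or above this level the
  derivative exists and is positive, so the function rises further just after it, a
  contradiction.\<close>

lemma nondecreasing_off_countable:
  fixes F G :: "real \<Rightarrow> real"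
  assumes ab: "a \<le> b" and N: "countable N" and cont: "continuous_on {a..b} F"
    and der: "\<And>x. x \<in> {a<..<b} - N \<Longrightarrow> (F has_real_derivative G x) (at x)"
    and nonneg: "\<And>x. x \<in> {a<..<b} - N \<Longrightarrow> 0 \<le> G x"
  shows "F a \<le> F b"
proof (rule ccontr)
  assume "\<not> F a \<le> F b"
  then have less: "F b < F a" by simp
  then have "a < b" using ab by (cases "a = b") auto
  \<comment> \<open>Half of the average descent, so that the tilted function \<open>H\<close> still
    falls from \<open>a\<close> to \<open>b\<close>.\<close>
  define e where "e = (F a - F b) / 2 / (b - a)"
  have "e > 0" "e * (b - a) = (F a - F b) / 2"
    using less \<open>a < b\<close> nonzero_eq_divide_eq[of "b - a" e "(F a - F b) / 2"] by (simp_all add: e_def)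
  then have e: "e > 0" "e * (b - a) < F a - F b" using less by auto
  define H where "H x = F x + e * x" for x
  have contH: "continuous_on {a..b} H"
    unfolding H_def by (intro continuous_intros cont)
  have Hba: "H b < H a" using e by (simp add: H_def algebra_simps)
  have "countable (H ` N)" using N by simp
  then obtain c where c: "H b < c" "c < H a" "c \<notin> H ` N"
    using uncountable_open_interval[of "H b" "H a"] Hba
    by (metis countable_subset greaterThanLessThan_iff subsetI)
  define S where "S = {x\<in>{a..b}. c \<le> H x}"
  have "S = {a..b} \<inter> H -` {c..}" unfolding S_def by auto
  then have "closed S"
    using continuous_closed_preimage[OF contH, of "{c..}"] by simp
  moreover have "a \<in> S" using c ab by (auto simp: S_def)
  moreover have "bdd_above S" unfolding S_def by auto
  ultimately have x0S: "Sup S \<in> S" and upper: "\<And>x. x \<in> S \<Longrightarrow> x \<le> Sup S"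
    using closed_contains_Sup[of S] by (auto intro: cSup_upper)
  define x0 where "x0 = Sup S"
  have x0: "x0 \<in> {a..b}" "c \<le> H x0" using x0S by (auto simp: S_def x0_def)
  have "x0 \<noteq> b" using x0 c by auto
  then have x0b: "x0 < b" using x0 by auto
  have right: "H x < c" if "x0 < x" "x \<le> b" for x
  proof (rule ccontr)
    assume "\<not> H x < c"
    then have "x \<in> S" using that x0 by (auto simp: S_def)
    then show False using upper[of x] that by (simp add: x0_def)
  qed
  have "H x0 = c"
  proof (rule ccontr)
    assume "H x0 \<noteq> c"
    then have "c < H x0" using x0 by simp
    moreover have "continuous_on {x0..b} H"
      using contH by (rule continuous_on_subset) (use x0 in auto)
    ultimately obtain y where "x0 \<le> y" "y \<le> b" "H y = c"
      using IVT2'[of H b c x0] c x0b by auto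
    then show False using right[of y] \<open>c < H x0\<close> by (cases "y = x0") auto
  qed
  \<comment> \<open>No point of \<open>N\<close> attains the level \<open>c\<close>, and
    \<open>H a\<close> lies strictly above it.\<close>
  then have "x0 \<notin> N" "x0 \<noteq> a" using c by auto
  then have x0': "x0 \<in> {a<..<b} - N" using x0 x0b by auto
  have "(H has_real_derivative (G x0 + e)) (at x0)"
    unfolding H_def using der[OF x0'] by (auto intro!: derivative_eq_intros)
  moreover have "G x0 + e > 0" using nonneg[OF x0'] e by simp
  ultimately obtain d where d: "d > 0" "\<And>h. 0 < h \<Longrightarrow> h < d \<Longrightarrow> H x0 < H (x0 + h)"
    using DERIV_pos_inc_right by blast
  define h where "h = min (d / 2) (b - x0)"
  have "0 < h" "h < d" "x0 + h \<le> b" using d x0b by (auto simp: h_def)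
  then show False using d(2)[of h] right[of "x0 + h"] \<open>H x0 = c\<close> by auto
qed

lemma constant_off_countable:
  fixes F :: "real \<Rightarrow> real"
  assumes "a \<le> b" "countable N" "continuous_on {a..b} F"
    and der: "\<And>x. x \<in> {a<..<b} - N \<Longrightarrow> (F has_real_derivative 0) (at x)"
  shows "F a = F b"
proof (rule antisym)
  show "F a \<le> F b"
    by (rule nondecreasing_off_countable[OF assms]) auto
  have "- F a \<le> - F b"
    by (rule nondecreasing_off_countable[of a b N "\<lambda>x. - F x" "\<lambda>x. 0"])
       (use assms in \<open>auto intro!: continuous_intros derivative_eq_intros\<close>)
  then show "F b \<le> F a" by simp
qed

section \<open>Linear second-order equations with a bounded measurable coefficient\<close>

lemma bounded_measurable_times_continuous_integrable:
  fixes q f :: "real \<Rightarrow> real"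
  assumes q: "q \<in> borel_measurable lebesgue" "\<And>x. \<bar>q x\<bar> \<le> K"
    and f: "continuous_on {a..b} f"
  shows "(\<lambda>x. q x * f x) absolutely_integrable_on {a..b}"
proof -
  have "bounded (range q)" using q(2) by (auto simp: bounded_iff)
  then have "bounded (q ` {a..b})" by (rule bounded_subset) auto
  moreover have "q \<in> borel_measurable (lebesgue_on {a..b})"
    using q(1) by (rule measurable_restrict_space1)
  moreover have "f absolutely_integrable_on {a..b}"
    using f by (metis absolutely_integrable_continuous box_real(2))
  ultimately show ?thesis
    using absolutely_integrable_bounded_measurable_product_real[of q "{a..b}" f] by auto
qed

text \<open>Serves to pass to the limit in the Picard iteration below: the integral operator is
  Lipschitz in the supremum norm with constant \<open>K * \<bar>b - a\<bar>\<close>.\<close>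

lemma uniform_limit_indefinite_integral:
  fixes q g :: "real \<Rightarrow> real" and f :: "nat \<Rightarrow> real \<Rightarrow> real"
  assumes q: "q \<in> borel_measurable lebesgue" "\<And>x. \<bar>q x\<bar> \<le> K"
    and f: "\<And>n. continuous_on {a..b} (f n)" "uniform_limit {a..b} f g sequentially"
  shows "uniform_limit {a..b} (\<lambda>n t. integral {a..t} (\<lambda>r. q r * f n r))
           (\<lambda>t. integral {a..t} (\<lambda>r. q r * g r)) sequentially"
proof (rule uniform_limitI)
  fix e :: real assume "e > 0"
  have g: "continuous_on {a..b} g"
    by (rule uniform_limit_theorem[OF _ f(2)]) (use f(1) in auto)
  have K: "K \<ge> 0" using q(2)[of 0] by linarith
  \<comment> \<open>Adding 1 keeps the denominator positive when \<open>K\<close> or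
    \<open>b - a\<close> is zero.\<close>
  define d where "d = e / (K * \<bar>b - a\<bar> + 1)"
  have pos: "K * \<bar>b - a\<bar> + 1 > 0" using K by (simp add: add_nonneg_pos)
  then have d: "d > 0" using \<open>e > 0\<close> by (simp add: d_def)
  have "K * d * \<bar>b - a\<bar> < (K * \<bar>b - a\<bar> + 1) * d" using d by (simp add: algebra_simps)
  also have "\<dots> = e" using pos by (simp add: d_def)
  finally have de: "K * d * \<bar>b - a\<bar> < e" .
  have "eventually (\<lambda>n. \<forall>x\<in>{a..b}. dist (f n x) (g x) < d) sequentially"
    using f(2) d by (rule uniform_limitD)
  then show "eventually (\<lambda>n. \<forall>t\<in>{a..b}. dist (integral {a..t} (\<lambda>r. q r * f n r))
      (integral {a..t} (\<lambda>r. q r * g r)) < e) sequentially"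
  proof (eventually_elim, intro ballI)
    fix n t assume n: "\<forall>x\<in>{a..b}. dist (f n x) (g x) < d" and t: "t \<in> {a..b}"
    have int: "(\<lambda>r. q r * h r) integrable_on {a..t}" if "continuous_on {a..b} h" for h
    proof -
      have "continuous_on {a..t} h" using that by (rule continuous_on_subset) (use t in auto)
      then show ?thesis
        using bounded_measurable_times_continuous_integrable[OF q] set_lebesgue_integral_eq_integral(1) by blast
    qed
    have "integral {a..t} (\<lambda>r. q r * f n r) - integral {a..t} (\<lambda>r. q r * g r)
        = integral {a..t} (\<lambda>r. q r * f n r - q r * g r)"
      using int[OF f(1)] int[OF g] by (rule integral_diff[symmetric])
    moreover have "norm (integral {a..t} (\<lambda>r. q r * f n r - q r * g r)) \<le> integral {a..t} (\<lambda>r. K * d)"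
    proof (rule integral_norm_bound_integral)
      show "(\<lambda>r. q r * f n r - q r * g r) integrable_on {a..t}"
        by (intro integrable_diff int f g)
      fix r assume "r \<in> {a..t}"
      then have "\<bar>f n r - g r\<bar> \<le> d" using n t by (force simp: dist_real_def)
      then have "\<bar>q r\<bar> * \<bar>f n r - g r\<bar> \<le> K * d"
        using q(2)[of r] K by (intro mult_mono) auto
      then show "norm (q r * f n r - q r * g r) \<le> K * d"
        by (simp add: abs_mult[symmetric] right_diff_distrib)
    qed auto
    moreover have "integral {a..t} (\<lambda>r. K * d) \<le> K * d * \<bar>b - a\<bar>"
    proof -
      have "(t - a) * (K * d) \<le> \<bar>b - a\<bar> * (K * d)"
        using t K d by (intro mult_right_mono) auto
      then show ?thesis using t by (simp add: mult_ac)
    qed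
    ultimately show "dist (integral {a..t} (\<lambda>r. q r * f n r)) (integral {a..t} (\<lambda>r. q r * g r)) < e"
      using de by (simp add: dist_real_def)
  qed
qed

lemma continuous_indefinite_integral_times:
  fixes q f :: "real \<Rightarrow> real"
  assumes q: "q \<in> borel_measurable lebesgue" "\<And>x. \<bar>q x\<bar> \<le> K"
    and f: "continuous_on {a..b} f"
  shows "continuous_on {a..b} (\<lambda>t. integral {a..t} (\<lambda>r. q r * f r))"
  using bounded_measurable_times_continuous_integrable[OF assms]
  by (intro indefinite_integral_continuous_1 set_lebesgue_integral_eq_integral(1))

text \<open>The inner integral is estimated crudely by \<open>K * l\<close> times the bound at its
  end point; the outer one is computed exactly and produces the next factorial. One factorial per
  double integration already gives a convergent majorant.\<close>

lemma volterra_bound: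
  fixes q f :: "real \<Rightarrow> real"
  assumes q: "q \<in> borel_measurable lebesgue" "\<And>x. \<bar>q x\<bar> \<le> K"
    and f: "continuous_on {0..l} f" "\<And>x. x \<in> {0..l} \<Longrightarrow> \<bar>f x\<bar> \<le> G * (K * l * x) ^ n / fact n"
    and G: "G \<ge> 0" and x: "x \<in> {0..l}"
  shows "\<bar>integral {0..x} (\<lambda>t. integral {0..t} (\<lambda>r. q r * f r))\<bar> \<le> G * (K * l * x) ^ Suc n / fact (Suc n)"
proof -
  have K: "K \<ge> 0" using q(2)[of 0] by linarith
  have l: "l \<ge> 0" using x by auto
  have inner: "\<bar>integral {0..t} (\<lambda>r. q r * f r)\<bar> \<le> K * l * (G * (K * l * t) ^ n / fact n)"
    if t: "t \<in> {0..l}" for t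
  proof -
    define B where "B = G * (K * l * t) ^ n / fact n"
    have B0: "B \<ge> 0" using t K l G by (simp add: B_def)
    have "norm (integral {0..t} (\<lambda>r. q r * f r)) \<le> integral {0..t} (\<lambda>r. K * B)"
    proof (rule integral_norm_bound_integral)
      have "continuous_on {0..t} f" using f(1) by (rule continuous_on_subset) (use t in auto)
      then show "(\<lambda>r. q r * f r) integrable_on {0..t}"
        using bounded_measurable_times_continuous_integrable[OF q] set_lebesgue_integral_eq_integral(1) by blast
      fix r assume r: "r \<in> {0..t}"
      have "\<bar>f r\<bar> \<le> G * (K * l * r) ^ n / fact n" using f(2)[of r] r t by auto
      also have "\<dots> \<le> B" unfolding B_def
        using r t K l G by (intro divide_right_mono mult_left_mono power_mono) auto
      finally show "norm (q r * f r) \<le> K * B"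
        using q(2)[of r] K by (simp add: abs_mult mult_mono)
    qed auto
    also have "\<dots> = t * (K * B)" using t by simp
    also have "\<dots> \<le> l * (K * B)" using t K B0 by (intro mult_right_mono) auto
    finally show ?thesis by (simp add: B_def mult_ac)
  qed
  define c where "c = G * (K * l) ^ Suc n / fact n"
  have "continuous_on {0..x} (\<lambda>t. integral {0..t} (\<lambda>r. q r * f r))"
    using continuous_indefinite_integral_times[OF q f(1)] by (rule continuous_on_subset) (use x in auto)
  then have "norm (integral {0..x} (\<lambda>t. integral {0..t} (\<lambda>r. q r * f r)))
      \<le> integral {0..x} (\<lambda>t. c * t ^ n)"
  proof (intro integral_norm_bound_integral integrable_continuous_interval)
    fix t assume "t \<in> {0..x}"
    then have "t \<in> {0..l}" using x by auto
    from inner[OF this] show "norm (integral {0..t} (\<lambda>r. q r * f r)) \<le> c * t ^ n"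
      by (simp add: c_def power_mult_distrib mult_ac)
  qed (auto intro!: continuous_intros)
  also have "integral {0..x} (\<lambda>t. c * t ^ n) = c * x ^ Suc n / Suc n - c * 0 ^ Suc n / Suc n"
  proof (rule integral_unique, rule fundamental_theorem_of_calculus)
    fix t assume "t \<in> {0..x}"
    have "((\<lambda>t. c * t ^ Suc n / Suc n) has_real_derivative (c * t ^ n)) (at t within {0..x})"
      by (rule derivative_eq_intros refl | simp del: of_nat_Suc)+
    then show "((\<lambda>t. c * t ^ Suc n / Suc n) has_vector_derivative (c * t ^ n)) (at t within {0..x})"
      by (simp add: has_real_derivative_iff_has_vector_derivative)
  qed (use x in auto)
  also have "\<dots> = G * (K * l * x) ^ Suc n / fact (Suc n)"
    by (simp add: c_def power_mult_distrib mult_ac)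
  finally show ?thesis by simp
qed

text \<open>Picard iteration written as a series: \<open>D 0\<close> solves the equation with zero
  coefficient, and each further term is the double integral of \<open>q\<close> times its
  predecessor. An exponential series majorises the terms, so the partial sums converge uniformly and
  the integral equation survives the limit.\<close>

lemma linear_second_order_ode_exists:
  fixes q :: "real \<Rightarrow> real"
  assumes q: "q \<in> borel_measurable lebesgue" "\<And>x. \<bar>q x\<bar> \<le> K" and l: "0 \<le> l"
  obtains y p where "continuous_on {0..l} y" "continuous_on {0..l} p"
    "\<And>x. x \<in> {0..l} \<Longrightarrow> y x = a + integral {0..x} p"
    "\<And>x. x \<in> {0..l} \<Longrightarrow> p x = b + integral {0..x} (\<lambda>t. q t * y t)"
proof -
  have K: "K \<ge> 0" using q(2)[of 0] by linarith
  define J where "J f x = integral {0..x} (\<lambda>t. q t * f t)" for f :: "real \<Rightarrow> real" and x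
  define D where "D n = rec_nat (\<lambda>x. a + b * x) (\<lambda>_ f x. integral {0..x} (J f)) n" for n :: nat
  have D0: "D 0 x = a + b * x" and DS: "D (Suc n) x = integral {0..x} (J (D n))" for n x
    by (simp_all add: D_def)
  have Jcont: "continuous_on {0..l} (J f)" if "continuous_on {0..l} f" for f
    unfolding J_def by (rule continuous_indefinite_integral_times[OF q that])
  have Icont: "continuous_on {0..l} (\<lambda>x. integral {0..x} f)" if "continuous_on {0..l} f" for f :: "real \<Rightarrow> real"
    using that by (intro indefinite_integral_continuous_1 integrable_continuous_interval)
  have Dcont: "continuous_on {0..l} (D n)" for n
  proof (induction n)
    case 0
    have "continuous_on {0..l} (\<lambda>x. a + b * x)" by (intro continuous_intros)
    then show ?case by (simp add: D0[abs_def])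
  next
    case (Suc n)
    show ?case using Icont[OF Jcont[OF Suc]] by (simp add: DS[abs_def])
  qed
  define G where "G = \<bar>a\<bar> + \<bar>b\<bar> * l"
  have G: "G \<ge> 0" using l by (simp add: G_def)
  have Dbound: "\<bar>D n x\<bar> \<le> G * (K * l * x) ^ n / fact n" if "x \<in> {0..l}" for n x
    using that
  proof (induction n arbitrary: x)
    case 0
    have "\<bar>a + b * x\<bar> \<le> \<bar>a\<bar> + \<bar>b * x\<bar>" by simp
    also have "\<dots> \<le> G" using 0 by (auto simp: G_def abs_mult intro: mult_left_mono)
    finally show ?case by (simp add: D0)
  next
    case (Suc n)
    show ?case
      using volterra_bound[OF q Dcont Suc.IH G Suc.prems] by (simp add: DS J_def[abs_def])
  qed
  define y where "y x = (\<Sum>n. D n x)" for x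
  define S where "S n x = (\<Sum>i<n. D i x)" for n x
  have lim: "uniform_limit {0..l} S y sequentially"
    unfolding S_def y_def
  proof (rule Weierstrass_m_test)
    fix n x assume x: "x \<in> {0..l}"
    have "G * (K * l * x) ^ n / fact n \<le> G * (K * l * l) ^ n / fact n"
      using x K l G by (intro divide_right_mono mult_left_mono power_mono) auto
    with Dbound[OF x, of n] show "norm (D n x) \<le> G * ((K * l * l) ^ n / fact n)" by simp
  next
    have "summable (\<lambda>n. G * (inverse (fact n) * (K * l * l) ^ n))"
      by (intro summable_mult summable_exp)
    then show "summable (\<lambda>n. G * ((K * l * l) ^ n / fact n))" by (simp add: field_simps)
  qed
  have Scont: "continuous_on {0..l} (S n)" for n
    unfolding S_def by (intro continuous_intros Dcont)
  have ycont: "continuous_on {0..l} y"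
    by (rule uniform_limit_theorem[OF _ lim]) (use Scont in auto)
  have JS: "J (S n) x = (\<Sum>i<n. J (D i) x)" if "x \<in> {0..l}" for n x
  proof -
    have "(\<lambda>t. q t * D i t) integrable_on {0..x}" for i
    proof -
      have "continuous_on {0..x} (D i)" using Dcont by (rule continuous_on_subset) (use that in auto)
      then show ?thesis
        using bounded_measurable_times_continuous_integrable[OF q] set_lebesgue_integral_eq_integral(1) by blast
    qed
    then show ?thesis unfolding J_def S_def by (simp add: sum_distrib_left integral_sum)
  qed
  have IS: "S (Suc n) x = a + b * x + integral {0..x} (J (S n))" if x: "x \<in> {0..l}" for n x
  proof -
    have "integral {0..x} (J (S n)) = integral {0..x} (\<lambda>t. \<Sum>i<n. J (D i) t)"
      by (rule integral_cong) (use JS x in auto)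
    also have "\<dots> = (\<Sum>i<n. integral {0..x} (J (D i)))"
    proof (rule integral_sum)
      fix i
      have "continuous_on {0..x} (J (D i))"
        using Jcont[OF Dcont] by (rule continuous_on_subset) (use x in auto)
      then show "J (D i) integrable_on {0..x}" by (rule integrable_continuous_interval)
    qed simp
    also have "\<dots> = (\<Sum>i<n. D (Suc i) x)" by (simp add: DS)
    finally show ?thesis
      unfolding S_def by (subst sum.lessThan_Suc_shift) (simp add: D0)
  qed
  have limJ: "uniform_limit {0..l} (\<lambda>n. J (S n)) (J y) sequentially"
    unfolding J_def by (rule uniform_limit_indefinite_integral[OF q Scont lim])
  \<comment> \<open>The trivial coefficient 1 lets the same limit lemma treat the outer
    integral.\<close>
  have limI: "uniform_limit {0..l} (\<lambda>n t. integral {0..t} (\<lambda>r. 1 * J (S n) r))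
           (\<lambda>t. integral {0..t} (\<lambda>r. 1 * J y r)) sequentially"
    by (rule uniform_limit_indefinite_integral[where K = 1]) (use Jcont[OF Scont] limJ in auto)
  have yeq: "y x = a + b * x + integral {0..x} (J y)" if x: "x \<in> {0..l}" for x
  proof (rule LIMSEQ_unique)
    have "(\<lambda>n. S n x) \<longlonglongrightarrow> y x" by (rule tendsto_uniform_limitI[OF lim x])
    then show "(\<lambda>n. S (Suc n) x) \<longlonglongrightarrow> y x" by (rule LIMSEQ_Suc)
    have "(\<lambda>n. integral {0..x} (J (S n))) \<longlonglongrightarrow> integral {0..x} (J y)"
      using tendsto_uniform_limitI[OF limI x] by simp
    then have "(\<lambda>n. a + b * x + integral {0..x} (J (S n))) \<longlonglongrightarrow> a + b * x + integral {0..x} (J y)"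
      by (intro tendsto_intros)
    then show "(\<lambda>n. S (Suc n) x) \<longlonglongrightarrow> a + b * x + integral {0..x} (J y)"
      by (simp add: IS[OF x])
  qed
  define p where "p x = b + J y x" for x
  have pcont: "continuous_on {0..l} p"
    unfolding p_def by (intro continuous_intros Jcont ycont)
  show thesis
  proof (rule that[OF ycont pcont])
    fix x assume x: "x \<in> {0..l}"
    have "continuous_on {0..x} (J y)" using Jcont[OF ycont] by (rule continuous_on_subset) (use x in auto)
    then have "integral {0..x} p = integral {0..x} (\<lambda>_. b) + integral {0..x} (J y)"
      unfolding p_def[abs_def] by (intro integral_add integrable_continuous_interval) auto
    then show "y x = a + integral {0..x} p" using yeq[OF x] x by simp
    show "p x = b + integral {0..x} (\<lambda>t. q t * y t)" by (simp add: p_def J_def)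
  qed
qed

section \<open>Shooting on the half interval\<close>

text \<open>\<open>l\<close> stands for \<open>L / 2\<close>, and \<open>N\<close> contains all
  discontinuities of \<open>v\<close>. Monotonicity is asked at positive points only, so the value
  of \<open>v\<close> at 0 may be smaller than nearby values.\<close>

locale symmetric_barrier =
  fixes v :: "real \<Rightarrow> real" and l :: real and N :: "real set" and M :: real
  assumes l: "0 < l" and N: "countable N" and v_meas: "v \<in> borel_measurable lebesgue"
    and v_nonneg: "0 \<le> v x" and v_le: "v x \<le> M" and v_even: "v (- x) = v x"
    and v_dec: "0 < x \<Longrightarrow> x \<le> x' \<Longrightarrow> v x' \<le> v x"
    and v_cont: "x \<notin> N \<Longrightarrow> isCont v x"
begin

text \<open>The derivative \<open>p\<close> of \<open>y\<close> is one-sided at the ends. The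
  second-order equation is imposed only off \<open>N\<close>; continuity of \<open>p\<close> makes
  up for the missing points, since a continuous function is controlled by its derivative off a
  countable set.\<close>

definition sol :: "real \<Rightarrow> (real \<Rightarrow> real) \<Rightarrow> (real \<Rightarrow> real) \<Rightarrow> bool" where
  "sol E y p \<longleftrightarrow>
     (\<forall>x\<in>{0..l}. (y has_real_derivative p x) (at x within {0..l})) \<and> continuous_on {0..l} p \<and>
     (\<forall>x\<in>{0<..<l} - N. (p has_real_derivative (v x - E) * y x) (at x))"

lemma sol_exists: "\<exists>y p. sol E y p \<and> y 0 = a \<and> p 0 = b"
proof -
  have q: "(\<lambda>x. v x - E) \<in> borel_measurable lebesgue" using v_meas by measurable
  have qb: "\<bar>v x - E\<bar> \<le> M + \<bar>E\<bar>" for x using v_nonneg[of x] v_le[of x] by linarith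
  obtain y p where yp: "continuous_on {0..l} y" "continuous_on {0..l} p"
    "\<And>x. x \<in> {0..l} \<Longrightarrow> y x = a + integral {0..x} p"
    "\<And>x. x \<in> {0..l} \<Longrightarrow> p x = b + integral {0..x} (\<lambda>t. (v t - E) * y t)"
    using linear_second_order_ode_exists[OF q qb less_imp_le[OF l], of a b] by blast
  have "sol E y p" unfolding sol_def
  proof (intro conjI ballI yp)
    fix x assume x: "x \<in> {0..l}"
    have "((\<lambda>x. a + integral {0..x} p) has_real_derivative p x) (at x within {0..l})"
      using integral_has_real_derivative[OF yp(2) x] by (auto intro!: derivative_eq_intros)
    then show "(y has_real_derivative p x) (at x within {0..l})"
      by (rule has_field_derivative_transform_within[of _ _ _ _ 1]) (use x yp(3) in auto)
  next
    fix x assume x: "x \<in> {0<..<l} - N"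
    have ycont: "isCont y x" using x yp(1)
      by (metis DiffD1 at_within_Icc_at continuous_on_eq_continuous_within greaterThanLessThan_iff
          atLeastAtMost_iff less_imp_le)
    have "isCont (\<lambda>t. (v t - E) * y t) x"
      using x v_cont ycont by (intro continuous_intros) auto
    then have "((\<lambda>u. integral {0..u} (\<lambda>t. (v t - E) * y t)) has_vector_derivative (v x - E) * y x)
        (at x within ({0..l} - {}))"
      using bounded_measurable_times_continuous_integrable[OF q qb yp(1)] x
      by (intro integral_has_vector_derivative_continuous_at)
         (auto intro: set_lebesgue_integral_eq_integral(1) continuous_at_imp_continuous_at_within)
    then have "((\<lambda>u. integral {0..u} (\<lambda>t. (v t - E) * y t)) has_real_derivative (v x - E) * y x)
        (at x within {0..l})"
      by (simp add: has_real_derivative_iff_has_vector_derivative)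
    then have "((\<lambda>u. b + integral {0..u} (\<lambda>t. (v t - E) * y t)) has_real_derivative (v x - E) * y x)
        (at x within {0..l})"
      by (auto intro!: derivative_eq_intros)
    then have "(p has_real_derivative (v x - E) * y x) (at x within {0..l})"
      by (rule has_field_derivative_transform_within[of _ _ _ _ 1]) (use x yp(4) in auto)
    then show "(p has_real_derivative (v x - E) * y x) (at x)"
      using x by (simp add: at_within_Icc_at)
  qed
  moreover have "y 0 = a" "p 0 = b" using yp(3)[of 0] yp(4)[of 0] l by auto
  ultimately show ?thesis by blast
qed

lemma sol_cont:
  assumes "sol E y p" shows "continuous_on {0..l} y" "continuous_on {0..l} p"
  using assms by (auto simp: sol_def intro: DERIV_continuous_on)

lemma sol_deriv:
  assumes "sol E y p" "x \<in> {0<..<l}" shows "(y has_real_derivative p x) (at x)"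
proof -
  have "(y has_real_derivative p x) (at x within {0..l})" using assms by (auto simp: sol_def)
  then show ?thesis using assms by (simp add: at_within_Icc_at)
qed

lemma sol_deriv2:
  assumes "sol E y p" "x \<in> {0<..<l} - N" shows "(p has_real_derivative (v x - E) * y x) (at x)"
  using assms by (auto simp: sol_def)

lemma nondecreasing_on:
  assumes x: "0 \<le> x" "x \<le> x'" "x' \<le> l" and "continuous_on {0..l} F"
    and "\<And>x. x \<in> {0<..<l} - N \<Longrightarrow> (F has_real_derivative G x) (at x)"
    and "\<And>x. x \<in> {0<..<l} - N \<Longrightarrow> 0 \<le> G x"
  shows "F x \<le> F x'"
  by (rule nondecreasing_off_countable[OF x(2) N continuous_on_subset[OF assms(4)], of G])
     (use assms in auto)

section \<open>Wronskians, dependence on the energy, and zeros\<close>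

lemma wronskian_deriv:
  assumes y: "sol E y p" and z: "sol E' z r" and x: "x \<in> {0<..<l} - N"
  shows "((\<lambda>x. y x * r x - z x * p x) has_real_derivative (E - E') * y x * z x) (at x)"
  using sol_deriv[OF y] sol_deriv[OF z] sol_deriv2[OF y x] sol_deriv2[OF z x] x
  by (auto intro!: derivative_eq_intros simp: algebra_simps)

text \<open>Takes the place of the uniqueness theorem for initial value problems: it excludes double
  zeros and yields the coefficients of a solution in a fundamental system.\<close>

lemma wronskian_const:
  assumes y: "sol E y p" and z: "sol E z r" and x: "x \<in> {0..l}"
  shows "y x * r x - z x * p x = y 0 * r 0 - z 0 * p 0"
proof -
  have "continuous_on {0..x} (\<lambda>x. y x * r x - z x * p x)"
    by (intro continuous_intros; rule continuous_on_subset[of "{0..l}"])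
       (use sol_cont[OF y] sol_cont[OF z] x in auto)
  then show ?thesis
    using constant_off_countable[of 0 x N "\<lambda>x. y x * r x - z x * p x"] N x wronskian_deriv[OF y z]
    by auto
qed

text \<open>Gronwall's argument: the derivative \<open>2 * y x * p x * (1 + (v x - E))\<close> of
  the sum of squares is at most \<open>k\<close> times that sum, so the weight
  \<open>exp (- k * x)\<close> makes it nonincreasing. The bound depends on \<open>E\<close> only
  through \<open>R\<close>.\<close>

lemma sol_energy_bound:
  assumes y: "sol E y p" and E: "\<bar>E\<bar> \<le> R" and x: "x \<in> {0..l}"
  shows "(y x)\<^sup>2 + (p x)\<^sup>2 \<le> ((y 0)\<^sup>2 + (p 0)\<^sup>2) * exp ((1 + M + R) * l)"
proof -
  define k where "k = 1 + M + R"
  have k: "k > 0" using v_nonneg[of 0] v_le[of 0] E by (simp add: k_def)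
  let ?F = "\<lambda>x. - ((y x)\<^sup>2 + (p x)\<^sup>2) * exp (- k * x)"
  let ?G = "\<lambda>x. exp (- k * x) * (k * ((y x)\<^sup>2 + (p x)\<^sup>2) - 2 * y x * p x * (1 + (v x - E)))"
  have "?F 0 \<le> ?F x"
  proof (rule nondecreasing_on[where F = ?F and G = ?G])
    show "continuous_on {0..l} ?F" by (intro continuous_intros sol_cont[OF y])
    fix x assume x: "x \<in> {0<..<l} - N"
    show "(?F has_real_derivative ?G x) (at x)"
      using sol_deriv[OF y, of x] sol_deriv2[OF y x] x
      by (auto intro!: derivative_eq_intros simp: algebra_simps power2_eq_square)
    have "\<bar>1 + (v x - E)\<bar> \<le> k" using v_nonneg[of x] v_le[of x] E by (simp add: k_def abs_le_iff)
    moreover have "\<bar>2 * y x * p x\<bar> \<le> (y x)\<^sup>2 + (p x)\<^sup>2"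
      using zero_le_power2[of "y x + p x"] zero_le_power2[of "y x - p x"]
      by (simp add: power2_sum power2_diff abs_le_iff)
    ultimately have "\<bar>2 * y x * p x\<bar> * \<bar>1 + (v x - E)\<bar> \<le> ((y x)\<^sup>2 + (p x)\<^sup>2) * k"
      by (intro mult_mono) auto
    then have "2 * y x * p x * (1 + (v x - E)) \<le> k * ((y x)\<^sup>2 + (p x)\<^sup>2)"
      by (simp add: abs_mult[symmetric] mult.commute[of k])
    then show "0 \<le> ?G x" by simp
  qed (use x in auto)
  then have "(y x)\<^sup>2 + (p x)\<^sup>2 \<le> ((y 0)\<^sup>2 + (p 0)\<^sup>2) * exp (k * x)"
    by (simp add: exp_minus field_simps)
  also have "\<dots> \<le> ((y 0)\<^sup>2 + (p 0)\<^sup>2) * exp (k * l)"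
    using x k by (intro mult_left_mono) auto
  finally show ?thesis by (simp add: k_def)
qed

text \<open>Gronwall's argument for the difference of two solutions with equal initial data, whose
  equation has the inhomogeneity \<open>(E - E') * y\<close>. The constant is fixed before the
  energies, hence uniform for energies of modulus at most \<open>R\<close>.\<close>

lemma sol_lipschitz_in_energy:
  obtains C where "C \<ge> 0"
    "\<And>E E' y p z r x. \<lbrakk>sol E y p; sol E' z r; y 0 = a; z 0 = a; p 0 = b; r 0 = b;
       \<bar>E\<bar> \<le> R; \<bar>E'\<bar> \<le> R; x \<in> {0..l}\<rbrakk> \<Longrightarrow> \<bar>z x - y x\<bar> \<le> C * \<bar>E - E'\<bar> \<and> \<bar>r x - p x\<bar> \<le> C * \<bar>E - E'\<bar>"
proof -
  define B where "B = (a\<^sup>2 + b\<^sup>2) * exp ((1 + M + R) * l)"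
  have B: "B \<ge> 0" by (simp add: B_def)
  \<comment> \<open>One more than the rate in \<open>sol_energy_bound\<close>: the extra 1 absorbs
    the square \<open>(r x - p x)\<^sup>2\<close> that arises when the inhomogeneous term is
    split.\<close>
  define k where "k = 2 + M + R"
  define C where "C = sqrt (B * l * exp (k * l))"
  show thesis
  proof (rule that[of C])
    show "C \<ge> 0" using B l by (simp add: C_def)
    fix E E' y p z r x
    assume y: "sol E y p" and z: "sol E' z r" and init: "y 0 = a" "z 0 = a" "p 0 = b" "r 0 = b"
      and E: "\<bar>E\<bar> \<le> R" "\<bar>E'\<bar> \<le> R" and x: "x \<in> {0..l}"
    have k: "k > 0" using v_nonneg[of 0] v_le[of 0] E by (simp add: k_def)
    let ?D = "\<lambda>x. (z x - y x)\<^sup>2 + (r x - p x)\<^sup>2"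
    let ?F = "\<lambda>x. (E - E')\<^sup>2 * B * x - ?D x * exp (- k * x)"
    let ?G = "\<lambda>x. (E - E')\<^sup>2 * B + exp (- k * x) *
        (k * ?D x - 2 * (z x - y x) * (r x - p x) * (1 + (v x - E')) - 2 * (r x - p x) * ((E - E') * y x))"
    have "?F 0 \<le> ?F x"
    proof (rule nondecreasing_on[where F = ?F and G = ?G])
      show "continuous_on {0..l} ?F" by (intro continuous_intros sol_cont[OF y] sol_cont[OF z])
      fix x assume x: "x \<in> {0<..<l} - N"
      show "(?F has_real_derivative ?G x) (at x)"
        using sol_deriv[OF y, of x] sol_deriv2[OF y x] sol_deriv[OF z, of x] sol_deriv2[OF z x] x
        by (auto intro!: derivative_eq_intros simp: algebra_simps power2_eq_square)
      have "\<bar>1 + (v x - E')\<bar> \<le> k - 1"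
        using v_nonneg[of x] v_le[of x] E by (simp add: k_def abs_le_iff)
      moreover have "\<bar>2 * (z x - y x) * (r x - p x)\<bar> \<le> ?D x"
        using zero_le_power2[of "(z x - y x) + (r x - p x)"] zero_le_power2[of "(z x - y x) - (r x - p x)"]
        by (simp add: power2_sum[of "z x - y x"] power2_diff[of "z x - y x"] abs_le_iff)
      ultimately have "\<bar>2 * (z x - y x) * (r x - p x)\<bar> * \<bar>1 + (v x - E')\<bar> \<le> ?D x * (k - 1)"
        by (intro mult_mono) auto
      then have 1: "2 * (z x - y x) * (r x - p x) * (1 + (v x - E')) \<le> ?D x * (k - 1)"
        using abs_ge_self[of "2 * (z x - y x) * (r x - p x) * (1 + (v x - E'))"]
        unfolding abs_mult[of "2 * (z x - y x) * (r x - p x)"] by (rule order_trans[rotated])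
      have 2: "2 * (r x - p x) * ((E - E') * y x) \<le> (r x - p x)\<^sup>2 + ((E - E') * y x)\<^sup>2"
        using zero_le_power2[of "(r x - p x) - (E - E') * y x"] by (simp add: power2_diff[of "r x - p x"])
      have "(y x)\<^sup>2 + (p x)\<^sup>2 \<le> B"
        using sol_energy_bound[OF y E(1), of x] x init by (simp add: B_def)
      then have "(y x)\<^sup>2 \<le> B" using zero_le_power2[of "p x"] by linarith
      then have "((E - E') * y x)\<^sup>2 \<le> (E - E')\<^sup>2 * B"
        by (simp add: power_mult_distrib mult_left_mono)
      then have 3: "- ((E - E')\<^sup>2 * B) \<le> k * ?D x - 2 * (z x - y x) * (r x - p x) * (1 + (v x - E'))
          - 2 * (r x - p x) * ((E - E') * y x)"
      proof -
        have "k * ?D x = ?D x * (k - 1) + ?D x" by (simp add: algebra_simps)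
        moreover have "((E - E') * y x)\<^sup>2 \<le> (E - E')\<^sup>2 * B" by fact
        ultimately show ?thesis using 1 2 zero_le_power2[of "z x - y x"] by linarith
      qed
      have ex: "0 < exp (- k * x)" "exp (- k * x) \<le> 1" using k x by auto
      have "exp (- k * x) * (- ((E - E')\<^sup>2 * B)) \<ge> 1 * (- ((E - E')\<^sup>2 * B))"
        using ex B by (intro mult_right_mono_neg) auto
      moreover have "exp (- k * x) * (- ((E - E')\<^sup>2 * B)) \<le> exp (- k * x) *
          (k * ?D x - 2 * (z x - y x) * (r x - p x) * (1 + (v x - E')) - 2 * (r x - p x) * ((E - E') * y x))"
        using ex by (intro mult_left_mono 3) auto
      ultimately show "0 \<le> ?G x" by linarith
    qed (use x in auto)
    then have "?D x * exp (- k * x) \<le> (E - E')\<^sup>2 * B * x" using init by simp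
    then have "?D x \<le> (E - E')\<^sup>2 * B * x * exp (k * x)" by (simp add: exp_minus field_simps)
    also have "\<dots> \<le> (E - E')\<^sup>2 * B * l * exp (k * l)"
      using x k B by (intro mult_mono) auto
    also have "\<dots> = (C * \<bar>E - E'\<bar>)\<^sup>2"
      using B l by (simp add: C_def power_mult_distrib mult_ac)
    finally have D: "?D x \<le> (C * \<bar>E - E'\<bar>)\<^sup>2" .
    have C0: "0 \<le> C * \<bar>E - E'\<bar>" using \<open>C \<ge> 0\<close> by simp
    have "(z x - y x)\<^sup>2 \<le> (C * \<bar>E - E'\<bar>)\<^sup>2" "(r x - p x)\<^sup>2 \<le> (C * \<bar>E - E'\<bar>)\<^sup>2"
      using D zero_le_power2[of "z x - y x"] zero_le_power2[of "r x - p x"] by linarith+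
    then show "\<bar>z x - y x\<bar> \<le> C * \<bar>E - E'\<bar> \<and> \<bar>r x - p x\<bar> \<le> C * \<bar>E - E'\<bar>"
      using C0 by (auto intro: power2_le_imp_le simp: abs_le_square_iff[symmetric])
  qed
qed

lemma sol_no_double_zero:
  assumes y: "sol E y p" and x: "x \<in> {0..l}" "y x = 0" "p x = 0"
  shows "y 0 = 0 \<and> p 0 = 0"
proof -
  \<comment> \<open>Rotating the initial data by a right angle makes the Wronskian at 0 equal to
    \<open>(y 0)\<^sup>2 + (p 0)\<^sup>2\<close>, while at \<open>x\<close> it vanishes.\<close>
  obtain z r where z: "sol E z r" "z 0 = - p 0" "r 0 = y 0" using sol_exists by metis
  have "(y 0)\<^sup>2 + (p 0)\<^sup>2 = 0"
    using wronskian_const[OF y z(1) x(1)] x z by (simp add: power2_eq_square)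
  then show ?thesis by (simp add: sum_power2_eq_zero_iff)
qed

text \<open>An interior zero of a nonnegative function is a local minimum, hence a double zero,
  which a nontrivial solution does not have.\<close>

lemma sol_pos_interior:
  assumes y: "sol E y p" and nt: "y 0 \<noteq> 0 \<or> p 0 \<noteq> 0"
    and nonneg: "\<And>x. x \<in> {0<..l} \<Longrightarrow> 0 \<le> y x" and x: "x \<in> {0<..<l}"
  shows "0 < y x"
proof (rule ccontr)
  assume "\<not> 0 < y x"
  then have yx: "y x = 0" using nonneg[of x] x by auto
  define d where "d = min x (l - x)"
  have "p x = 0"
  proof (rule DERIV_local_min[OF sol_deriv[OF y x]])
    show "0 < d" using x by (simp add: d_def)
    show "\<forall>u. \<bar>x - u\<bar> < d \<longrightarrow> y x \<le> y u" using yx nonneg by (auto simp: d_def abs_less_iff)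
  qed
  then show False using sol_no_double_zero[OF y _ yx] nt x by auto
qed

text \<open>Positivity on \<open>(0, l]\<close> is an open condition on the energy, by the Lipschitz
  estimate. For \<open>0 < a\<close> compactness gives a positive lower bound for \<open>y\<close>;
  for \<open>a = 0\<close> the zero at the left end needs separate care.\<close>

lemma sol_pos_open:
  assumes y: "sol E y p" and init: "y 0 = a" "p 0 = b" "0 < a \<or> (a = 0 \<and> 0 < b)"
    and pos: "\<And>x. x \<in> {0<..l} \<Longrightarrow> 0 < y x"
  obtains d where "d > 0"
    "\<And>E' z r x. \<lbrakk>sol E' z r; z 0 = a; r 0 = b; \<bar>E' - E\<bar> < d; x \<in> {0<..l}\<rbrakk> \<Longrightarrow> 0 < z x"
proof -
  obtain C where C: "C \<ge> 0" and lip: "\<And>F E' y p z r x. \<lbrakk>sol F y p; sol E' z r; y 0 = a; z 0 = a;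
      p 0 = b; r 0 = b; \<bar>F\<bar> \<le> \<bar>E\<bar> + 1; \<bar>E'\<bar> \<le> \<bar>E\<bar> + 1; x \<in> {0..l}\<rbrakk>
      \<Longrightarrow> \<bar>z x - y x\<bar> \<le> C * \<bar>F - E'\<bar> \<and> \<bar>r x - p x\<bar> \<le> C * \<bar>F - E'\<bar>"
    using sol_lipschitz_in_energy[of a b "\<bar>E\<bar> + 1"] by metis
  have close: "\<bar>z x - y x\<bar> < m \<and> \<bar>r x - p x\<bar> < m"
    if "m > 0" "sol E' z r" "z 0 = a" "r 0 = b" "\<bar>E' - E\<bar> < min 1 (m / (C + 1))" "x \<in> {0..l}" for m E' z r x
  proof -
    have "\<bar>E - E'\<bar> * (C + 1) < m" using that C by (simp add: pos_less_divide_eq abs_minus_commute)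
    moreover have "C * \<bar>E - E'\<bar> \<le> \<bar>E - E'\<bar> * (C + 1)" by (simp add: algebra_simps)
    moreover have "\<bar>z x - y x\<bar> \<le> C * \<bar>E - E'\<bar> \<and> \<bar>r x - p x\<bar> \<le> C * \<bar>E - E'\<bar>"
      using that by (intro lip[OF y that(2)] init) auto
    ultimately show ?thesis by linarith
  qed
  have bounded_below: "\<exists>m>0. \<forall>x\<in>{s..l}. m \<le> y x" if "0 \<le> s" "s \<le> l" "0 < y s" for s
  proof -
    have "continuous_on {s..l} y" using sol_cont(1)[OF y] by (rule continuous_on_subset) (use that in auto)
    moreover have "{s..l} \<noteq> {}" using that by auto
    ultimately obtain x where "x \<in> {s..l}" "\<forall>u\<in>{s..l}. y x \<le> y u"
      using continuous_attains_inf[OF compact_Icc] by blast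
    moreover have "0 < y x" using pos[of x] that \<open>x \<in> {s..l}\<close> by (cases "x = s") auto
    ultimately show ?thesis by blast
  qed
  show thesis
  proof (cases "0 < a")
    case True
    then obtain m where m: "m > 0" "\<forall>x\<in>{0..l}. m \<le> y x" using bounded_below[of 0] init l by auto
    show ?thesis
    proof (rule that)
      show "min 1 (m / (C + 1)) > 0" using m C by simp
      fix E' z r x
      assume "sol E' z r" "z 0 = a" "r 0 = b" "\<bar>E' - E\<bar> < min 1 (m / (C + 1))" "x \<in> {0<..l}"
      then have "\<bar>z x - y x\<bar> < m" "m \<le> y x" using close[of m E' z r x] m by auto
      then show "0 < z x" by linarith
    qed
  next
    case False
    then have ab: "a = 0" "0 < b" using init by auto
    \<comment> \<open>Since \<open>y\<close> vanishes at 0, its derivative is kept positive near 0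
      instead, and \<open>y\<close> is bounded below only from \<open>s\<close> on.\<close>
    obtain s where s: "0 < s" "s \<le> l" "\<And>x. x \<in> {0..s} \<Longrightarrow> b / 2 < p x"
    proof -
      obtain d where d: "d > 0" "\<And>x. x \<in> {0..l} \<Longrightarrow> dist x 0 < d \<Longrightarrow> dist (p x) (p 0) < b / 2"
        using sol_cont(2)[OF y] ab l unfolding continuous_on_iff
        by (metis atLeastAtMost_iff half_gt_zero less_imp_le order_refl)
      show thesis
      proof (rule that[of "min (d / 2) l"])
        fix x assume "x \<in> {0..min (d / 2) l}"
        then have "dist (p x) (p 0) < b / 2" using d(1) by (intro d(2)) (auto simp: dist_real_def)
        then show "b / 2 < p x" using init(2) unfolding dist_real_def by linarith
      qed (use d l in auto)
    qed
    obtain m where m: "m > 0" "\<forall>x\<in>{s..l}. m \<le> y x" using bounded_below[of s] pos[of s] s by auto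
    define m' where "m' = min m (b / 2)"
    have m': "m' > 0" "m' \<le> m" "m' \<le> b / 2" using m ab by (auto simp: m'_def)
    show ?thesis
    proof (rule that)
      show "min 1 (m' / (C + 1)) > 0" using m' C by simp
      fix E' z r x
      assume z: "sol E' z r" "z 0 = a" "r 0 = b" "\<bar>E' - E\<bar> < min 1 (m' / (C + 1))" and x: "x \<in> {0<..l}"
      show "0 < z x"
      proof (cases "x \<le> s")
        case True
        have "z 0 < z x"
        proof (rule DERIV_pos_imp_increasing_open[of 0 x z])
          show "0 < x" using x by simp
          show "continuous_on {0..x} z"
            using sol_cont(1)[OF z(1)] by (rule continuous_on_subset) (use x in auto)
          fix u assume u: "0 < u" "u < x"
          then have "\<bar>r u - p u\<bar> < m'" "b / 2 < p u"
            using close[OF m'(1) z, of u] s(3)[of u] True x by auto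
          then have "0 < r u" using m' by linarith
          moreover have "(z has_real_derivative r u) (at u)"
            using sol_deriv[OF z(1), of u] u x by auto
          ultimately show "\<exists>y. DERIV z u :> y \<and> 0 < y" by blast
        qed
        then show ?thesis using z ab by simp
      next
        case False
        then have "\<bar>z x - y x\<bar> < m'" "m \<le> y x" using close[OF m'(1) z, of x] m x by auto
        then show ?thesis using m' by linarith
      qed
    qed
  qed
qed

section \<open>The shooting argument\<close>

definition shoot :: "real \<Rightarrow> real \<Rightarrow> real \<Rightarrow> (real \<Rightarrow> real) \<times> (real \<Rightarrow> real)" where
  "shoot a b E = (SOME yp. sol E (fst yp) (snd yp) \<and> fst yp 0 = a \<and> snd yp 0 = b)"

lemma shoot:
  "sol E (fst (shoot a b E)) (snd (shoot a b E))" "fst (shoot a b E) 0 = a" "snd (shoot a b E) 0 = b"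
proof -
  have "\<exists>yp. sol E (fst yp) (snd yp) \<and> fst yp 0 = a \<and> snd yp 0 = b"
    using sol_exists[of E a b] by auto
  from someI_ex[OF this]
  show "sol E (fst (shoot a b E)) (snd (shoot a b E))" "fst (shoot a b E) 0 = a" "snd (shoot a b E) 0 = b"
    by (auto simp: shoot_def)
qed

text \<open>The end point \<open>l\<close> is included: this makes the condition open in the energy,
  and its failure at the critical energy yields the Dirichlet condition.\<close>

definition shoot_pos :: "real \<Rightarrow> real \<Rightarrow> real \<Rightarrow> bool" where
  "shoot_pos a b E \<longleftrightarrow> (\<forall>x\<in>{0<..l}. 0 < fst (shoot a b E) x)"

text \<open>\<open>E1\<close> is the supremum of the energies with a positive solution. It is not
  attained, because positivity is open; the solution at \<open>E1\<close> is nonnegative as a limit,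
  hence positive inside, so positivity can fail only at \<open>l\<close>. Monotonicity in the energy
  is avoided: the last conclusion merely provides positive solutions at energies above any
  \<open>E < E1\<close>.\<close>

lemma shooting:
  assumes init: "0 < a \<or> (a = 0 \<and> 0 < b)" and start: "shoot_pos a b E0"
    and bound: "\<And>E. shoot_pos a b E \<Longrightarrow> E \<le> B"
  obtains E1 where "E0 < E1" "E1 \<le> B" "fst (shoot a b E1) l = 0"
    "\<And>x. x \<in> {0<..<l} \<Longrightarrow> 0 < fst (shoot a b E1) x"
    "\<And>E. E < E1 \<Longrightarrow> \<exists>E'>E. shoot_pos a b E'"
proof -
  define A where "A = {E. shoot_pos a b E}"
  define E1 where "E1 = Sup A"
  have A: "A \<noteq> {}" "bdd_above A" using start bound by (auto simp: A_def intro!: bdd_aboveI[of _ B])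
  have approx: "\<exists>E'\<in>A. E < E'" if "E < E1" for E
    using that less_cSup_iff[OF A] by (simp add: E1_def)
  have upper: "E \<le> E1" if "shoot_pos a b E" for E
    using that A by (auto simp: E1_def A_def intro: cSup_upper)
  have notin: "\<not> shoot_pos a b E1"
  proof
    assume "shoot_pos a b E1"
    then obtain d where "d > 0" "\<And>E' z r x. \<lbrakk>sol E' z r; z 0 = a; r 0 = b; \<bar>E' - E1\<bar> < d; x \<in> {0<..l}\<rbrakk> \<Longrightarrow> 0 < z x"
      using sol_pos_open[OF shoot init, of E1] unfolding shoot_pos_def by metis
    then have "shoot_pos a b (E1 + d / 2)"
      using shoot[where E = "E1 + d / 2" and a = a and b = b] by (auto simp: shoot_pos_def)
    then show False using upper[of "E1 + d / 2"] \<open>d > 0\<close> by simp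
  qed
  have nonneg: "0 \<le> fst (shoot a b E1) x" if x: "x \<in> {0<..l}" for x
  proof (rule ccontr)
    assume neg: "\<not> 0 \<le> fst (shoot a b E1) x"
    define m where "m = - fst (shoot a b E1) x"
    have m: "m > 0" using neg by (simp add: m_def)
    obtain C where C: "C \<ge> 0" and lip: "\<And>E E' y p z r x. \<lbrakk>sol E y p; sol E' z r; y 0 = a; z 0 = a;
      p 0 = b; r 0 = b; \<bar>E\<bar> \<le> \<bar>E1\<bar> + 1; \<bar>E'\<bar> \<le> \<bar>E1\<bar> + 1; x \<in> {0..l}\<rbrakk>
      \<Longrightarrow> \<bar>z x - y x\<bar> \<le> C * \<bar>E - E'\<bar> \<and> \<bar>r x - p x\<bar> \<le> C * \<bar>E - E'\<bar>"
      using sol_lipschitz_in_energy[of a b "\<bar>E1\<bar> + 1"] by metis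
    \<comment> \<open>A change of energy below \<open>d\<close> moves the value at \<open>x\<close>
      by at most \<open>m\<close>, too little to make it positive.\<close>
    define d where "d = min 1 (m / (C + 1))"
    have d: "d > 0" using m C by (simp add: d_def)
    obtain E where E: "E \<in> A" "E1 - d < E" using approx[of "E1 - d"] d by auto
    have E': "E \<le> E1" "\<bar>E - E1\<bar> < d" using upper[of E] E by (auto simp: A_def)
    have "\<bar>E\<bar> \<le> \<bar>E1\<bar> + 1" using E'(2) unfolding d_def by linarith
    then have "\<bar>fst (shoot a b E1) x - fst (shoot a b E) x\<bar> \<le> C * \<bar>E - E1\<bar>"
      using lip[OF shoot(1) shoot(1) shoot(2) shoot(2) shoot(3) shoot(3), of E E1 x] x by auto
    also have "\<dots> \<le> (C + 1) * \<bar>E - E1\<bar>" by (simp add: algebra_simps)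
    also have "\<dots> \<le> m"
    proof -
      have "\<bar>E - E1\<bar> \<le> m / (C + 1)" using E' by (simp add: d_def)
      then show ?thesis using C by (simp add: pos_le_divide_eq mult.commute)
    qed
    finally have "fst (shoot a b E) x \<le> 0" by (simp add: m_def)
    moreover have "0 < fst (shoot a b E) x" using E x by (auto simp: A_def shoot_pos_def)
    ultimately show False by simp
  qed
  have nt: "fst (shoot a b E1) 0 \<noteq> 0 \<or> snd (shoot a b E1) 0 \<noteq> 0" using shoot init by auto
  have pos: "0 < fst (shoot a b E1) x" if "x \<in> {0<..<l}" for x
    using sol_pos_interior[OF shoot(1) nt nonneg that] .
  show thesis
  proof (rule that[of E1])
    show "E0 < E1" using upper[OF start] start notin by (cases "E0 = E1") auto
    show "E1 \<le> B" unfolding E1_def using A bound by (intro cSup_least) (auto simp: A_def)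
    obtain x where x: "x \<in> {0<..l}" "\<not> 0 < fst (shoot a b E1) x" using notin by (auto simp: shoot_pos_def)
    have "x = l"
    proof (rule ccontr)
      assume "x \<noteq> l" then show False using x pos[of x] by auto
    qed
    then show "fst (shoot a b E1) l = 0" using nonneg[OF x(1)] x by auto
    show "\<exists>E'>E. shoot_pos a b E'" if "E < E1" for E using approx[OF that] by (auto simp: A_def)
  qed (fact pos)
qed

section \<open>Comparison with the cosine and the gap estimate\<close>

text \<open>Stands in for the fact that a nonnegative integrand with integral at most 0 vanishes
  somewhere: \<open>F\<close> is forced to be constant, and the countable set \<open>N\<close>
  cannot exhaust the interval.\<close>

lemma deriv_vanishes_somewhere:
  assumes cont: "continuous_on {0..l} F" and ends: "F l \<le> F 0"
    and der: "\<And>x. x \<in> {0<..<l} - N \<Longrightarrow> (F has_real_derivative G x) (at x)"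
    and nonneg: "\<And>x. x \<in> {0<..<l} - N \<Longrightarrow> 0 \<le> G x"
  obtains x where "x \<in> {0<..<l} - N" "G x = 0"
proof -
  have const: "F x = F 0" if "x \<in> {0..l}" for x
    using nondecreasing_on[of 0 x F G] nondecreasing_on[of x l F G] that cont ends der nonneg
    by (auto intro: antisym)
  have "uncountable {0<..<l}" using l by (simp add: uncountable_open_interval)
  then have "{0<..<l} - N \<noteq> {}"
    using N by (metis Diff_eq_empty_iff countable_subset)
  then obtain x where x: "x \<in> {0<..<l} - N" by blast
  have "G x = 0"
  proof (rule DERIV_local_const[OF der[OF x]])
    show "0 < min x (l - x)" using x by auto
    show "\<forall>y. \<bar>x - y\<bar> < min x (l - x) \<longrightarrow> F x = F y"
    proof (intro allI impI)
      fix y assume "\<bar>x - y\<bar> < min x (l - x)"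
      then have "y \<in> {0..l}" by (auto simp: abs_less_iff)
      then show "F x = F y" using const[of x] const[of y] x by auto
    qed
  qed
  with x show thesis by (rule that)
qed

text \<open>With \<open>L = 2 * l\<close> this is \<open>pi / L\<close>;
  \<open>cos (\<kappa> * x)\<close> is the ground state of the free Dirichlet problem on
  \<open>(-l, l)\<close>, with energy \<open>\<kappa>\<^sup>2\<close>.\<close>

definition \<kappa> :: real where "\<kappa> = pi / (2 * l)"

lemma kappa_pos: "0 < \<kappa>" using l by (simp add: \<kappa>_def)

lemma kappa_l: "\<kappa> * l = pi / 2" using l by (simp add: \<kappa>_def)

lemma kappa_angle: "x \<in> {0<..<l} \<Longrightarrow> 0 < \<kappa> * x \<and> \<kappa> * x < pi / 2"
  using kappa_pos mult_strict_left_mono[of x l \<kappa>] by (auto simp: kappa_l)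

lemma cos_kappa_pos: "x \<in> {0<..<l} \<Longrightarrow> 0 < cos (\<kappa> * x)"
  using kappa_angle[of x] by (intro cos_gt_zero) auto

lemma sin_kappa_pos: "x \<in> {0<..<l} \<Longrightarrow> 0 < sin (\<kappa> * x)"
  using kappa_angle[of x] by (intro sin_gt_zero) auto

text \<open>Provides the starting energy for the even shooting. At energy 0 the derivative of
  \<open>y * p\<close> is \<open>p\<^sup>2 + v * y\<^sup>2\<close>, so \<open>y * p\<close> stays
  nonnegative, \<open>y\<^sup>2\<close> never drops below 1, and \<open>y\<close> cannot change
  sign.\<close>

lemma even_sol_zero_energy_pos:
  assumes y: "sol 0 y p" and init: "y 0 = 1" "p 0 = 0" and x: "x \<in> {0..l}"
  shows "0 < y x"
proof -
  have yp: "0 \<le> y x * p x" if "x \<in> {0..l}" for x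
  proof -
    have "y 0 * p 0 \<le> y x * p x"
    proof (rule nondecreasing_on[where F = "\<lambda>x. y x * p x" and G = "\<lambda>x. (p x)\<^sup>2 + v x * (y x)\<^sup>2"])
      show "continuous_on {0..l} (\<lambda>x. y x * p x)" by (intro continuous_intros sol_cont[OF y])
      fix x assume x: "x \<in> {0<..<l} - N"
      show "((\<lambda>x. y x * p x) has_real_derivative (p x)\<^sup>2 + v x * (y x)\<^sup>2) (at x)"
        using sol_deriv[OF y, of x] sol_deriv2[OF y x] x
        by (auto intro!: derivative_eq_intros simp: power2_eq_square)
      show "0 \<le> (p x)\<^sup>2 + v x * (y x)\<^sup>2" using v_nonneg by simp
    qed (use that in auto)
    then show ?thesis using init by simp
  qed
  have sq: "1 \<le> (y x)\<^sup>2" if "x \<in> {0..l}" for x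
  proof -
    have "(y 0)\<^sup>2 \<le> (y x)\<^sup>2"
    proof (rule nondecreasing_on[where F = "\<lambda>x. (y x)\<^sup>2" and G = "\<lambda>x. 2 * (y x * p x)"])
      show "continuous_on {0..l} (\<lambda>x. (y x)\<^sup>2)" by (intro continuous_intros sol_cont[OF y])
      fix x assume x: "x \<in> {0<..<l} - N"
      show "((\<lambda>x. (y x)\<^sup>2) has_real_derivative 2 * (y x * p x)) (at x)"
        using sol_deriv[OF y, of x] x by (auto intro!: derivative_eq_intros)
      show "0 \<le> 2 * (y x * p x)" using yp[of x] x by simp
    qed (use that in auto)
    then show ?thesis using init by simp
  qed
  show ?thesis
  proof (rule ccontr)
    assume "\<not> 0 < y x"
    moreover have "continuous_on {0..x} y"
      using sol_cont(1)[OF y] by (rule continuous_on_subset) (use x in auto)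
    ultimately obtain u where "0 \<le> u" "u \<le> x" "y u = 0"
      using IVT2'[of y x 0 0] x init by auto
    then show False using sq[of u] x by simp
  qed
qed

text \<open>The function is the Wronskian of the cosine with \<open>y\<close>; where the cosine is
  positive it equals its square times the derivative of \<open>y / cos\<close>.\<close>

lemma cos_wronskian_deriv:
  assumes y: "sol E y p" and x: "x \<in> {0<..<l} - N"
  shows "((\<lambda>x. p x * cos (\<kappa> * x) + \<kappa> * y x * sin (\<kappa> * x)) has_real_derivative
    (v x - E + \<kappa>\<^sup>2) * (y x * cos (\<kappa> * x))) (at x)"
  using sol_deriv[OF y, of x] sol_deriv2[OF y x] x
  by (auto intro!: derivative_eq_intros simp: algebra_simps power2_eq_square)

lemma cos_wronskian_cont:
  assumes y: "sol E y p"
  shows "continuous_on {0..l} (\<lambda>x. p x * cos (\<kappa> * x) + \<kappa> * y x * sin (\<kappa> * x))"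
  by (intro continuous_intros sol_cont[OF y])

text \<open>Sturm comparison, bounding the even shooting energies: for larger \<open>E\<close> the
  cosine Wronskian would be nonincreasing, yet it starts at 0 and ends at
  \<open>\<kappa> * y l > 0\<close>.\<close>

lemma even_sol_pos_imp_energy_le:
  assumes y: "sol E y p" and "p 0 = 0" and pos: "\<And>x. x \<in> {0<..l} \<Longrightarrow> 0 < y x"
  shows "E \<le> M + \<kappa>\<^sup>2"
proof (rule ccontr)
  assume E: "\<not> E \<le> M + \<kappa>\<^sup>2"
  let ?W = "\<lambda>x. p x * cos (\<kappa> * x) + \<kappa> * y x * sin (\<kappa> * x)"
  have "- ?W 0 \<le> - ?W l"
  proof (rule nondecreasing_on[where F = "\<lambda>x. - ?W x" and
        G = "\<lambda>x. - ((v x - E + \<kappa>\<^sup>2) * (y x * cos (\<kappa> * x)))"])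
    show "continuous_on {0..l} (\<lambda>x. - ?W x)"
      by (rule continuous_on_minus[OF cos_wronskian_cont[OF y]])
    fix x assume x: "x \<in> {0<..<l} - N"
    show "((\<lambda>x. - ?W x) has_real_derivative - ((v x - E + \<kappa>\<^sup>2) * (y x * cos (\<kappa> * x)))) (at x)"
      by (rule DERIV_minus[OF cos_wronskian_deriv[OF y x]])
    have "v x - E + \<kappa>\<^sup>2 \<le> 0" using v_le[of x] E by simp
    moreover have "0 \<le> y x * cos (\<kappa> * x)" using pos[of x] cos_kappa_pos[of x] x by auto
    ultimately show "0 \<le> - ((v x - E + \<kappa>\<^sup>2) * (y x * cos (\<kappa> * x)))"
      by (simp add: mult_nonpos_nonneg)
  qed (use l in auto)
  then have "\<kappa> * y l \<le> 0" using assms by (simp add: kappa_l)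
  then show False using kappa_pos pos[of l] l by (simp add: mult_le_0_iff)
qed

text \<open>
  Since \<open>v\<close> decreases, the factor \<open>v x - E + \<kappa>\<^sup>2\<close> changes sign at most once, from positive to negative;
  so the Wronskian with the cosine, which vanishes at both ends, first increases and then decreases.
\<close>
lemma cos_wronskian_nonneg:
  assumes u: "sol E u p" and "p 0 = 0" "u l = 0" and nonneg: "\<And>x. x \<in> {0..l} \<Longrightarrow> 0 \<le> u x"
    and x: "x \<in> {0<..<l}"
  shows "0 \<le> p x * cos (\<kappa> * x) + \<kappa> * u x * sin (\<kappa> * x)"
proof -
  let ?W = "\<lambda>x. p x * cos (\<kappa> * x) + \<kappa> * u x * sin (\<kappa> * x)"
  let ?G = "\<lambda>x. (v x - E + \<kappa>\<^sup>2) * (u x * cos (\<kappa> * x))"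
  have uc: "0 \<le> u t * cos (\<kappa> * t)" if "t \<in> {0<..<l}" for t
    using nonneg[of t] cos_kappa_pos[of t] that by auto
  have W0: "?W 0 = 0" "?W l = 0" using assms by (simp_all add: kappa_l)
  show ?thesis
  \<comment> \<open>A nonnegative factor at \<open>x\<close> is nonnegative on all of
    \<open>(0, x)\<close>, so the Wronskian is compared with its value at 0; a negative one stays
    negative up to \<open>l\<close>, and the comparison is with the value at
    \<open>l\<close>.\<close>
  proof (cases "0 \<le> v x - E + \<kappa>\<^sup>2")
    case True
    have "?W 0 \<le> ?W x"
    proof (rule nondecreasing_off_countable[where F = ?W and G = ?G, OF _ N])
      show "continuous_on {0..x} ?W"
        using cos_wronskian_cont[OF u] by (rule continuous_on_subset) (use x in auto)
      fix t assume t: "t \<in> {0<..<x} - N"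
      show "(?W has_real_derivative ?G t) (at t)" using cos_wronskian_deriv[OF u, of t] t x by auto
      have "v x \<le> v t" using v_dec[of t x] t by auto
      then have "0 \<le> v t - E + \<kappa>\<^sup>2" using True by linarith
      then show "0 \<le> ?G t" using mult_nonneg_nonneg[OF _ uc[of t]] t x by simp
    qed (use x in auto)
    then show ?thesis using W0 by simp
  next
    case False
    have "- ?W x \<le> - ?W l"
    proof (rule nondecreasing_off_countable[where F = "\<lambda>x. - ?W x" and G = "\<lambda>x. - ?G x", OF _ N])
      have "continuous_on {x..l} ?W"
        using cos_wronskian_cont[OF u] by (rule continuous_on_subset) (use x in auto)
      then show "continuous_on {x..l} (\<lambda>x. - ?W x)" by (rule continuous_on_minus)
      fix t assume t: "t \<in> {x<..<l} - N"
      show "((\<lambda>x. - ?W x) has_real_derivative - ?G t) (at t)"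
        using DERIV_minus[OF cos_wronskian_deriv[OF u, of t]] t x by auto
      have "v t \<le> v x" using v_dec[of x t] t x by auto
      then have "v t - E + \<kappa>\<^sup>2 \<le> 0" using False by linarith
      moreover have "0 \<le> u t * cos (\<kappa> * t)" using uc[of t] t x by auto
      ultimately show "0 \<le> - ?G t" by (simp add: mult_nonpos_nonneg)
    qed (use x in auto)
    then show ?thesis using W0 by simp
  qed
qed

text \<open>Provides the starting energy for the odd shooting. The Wronskian of \<open>u\<close> and
  \<open>s\<close> is 1, so \<open>s / u\<close> has derivative \<open>1 / u\<^sup>2\<close> and
  grows from 0. At \<open>l\<close>, where \<open>u\<close> vanishes, continuity and the Wronskian
  take over.\<close>

lemma odd_sol_pos_at_ground_energy:
  assumes u: "sol E u p" and u0: "u 0 = 1" "p 0 = 0" and ul: "u l = 0"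
    and upos: "\<And>x. x \<in> {0..<l} \<Longrightarrow> 0 < u x"
    and s: "sol E s r" and s0: "s 0 = 0" "r 0 = 1" and x: "x \<in> {0<..l}"
  shows "0 < s x"
proof -
  have wr: "u x * r x - s x * p x = 1" if "x \<in> {0..l}" for x
    using wronskian_const[OF u s that] u0 s0 by simp
  have nonneg: "0 \<le> s x" if x: "x \<in> {0<..<l}" for x
  proof -
    have contx: "continuous_on {0..x} f" if "continuous_on {0..l} f" for f :: "real \<Rightarrow> real"
      using that by (rule continuous_on_subset) (use x in auto)
    have "s 0 / u 0 \<le> s x / u x"
    proof (rule nondecreasing_off_countable[where F = "\<lambda>x. s x / u x" and G = "\<lambda>x. 1 / (u x)\<^sup>2", OF _ N])
      have "u t \<noteq> 0" if "t \<in> {0..x}" for t using upos[of t] that x by auto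
      then show "continuous_on {0..x} (\<lambda>x. s x / u x)"
        by (intro continuous_on_divide contx sol_cont[OF u] sol_cont[OF s]) auto
      fix t assume t: "t \<in> {0<..<x} - N"
      then have "u t \<noteq> 0" "r t * u t - s t * p t = 1" using upos[of t] wr[of t] x by (auto simp: mult.commute)
      then show "((\<lambda>x. s x / u x) has_real_derivative 1 / (u t)\<^sup>2) (at t)"
        using sol_deriv[OF u, of t] sol_deriv[OF s, of t] t x
        by (auto intro!: derivative_eq_intros simp: power2_eq_square)
    qed (use x in auto)
    then show ?thesis using s0 upos[of x] x by (simp add: zero_le_divide_iff)
  qed
  have "0 \<le> s l"
  proof (rule ccontr)
    assume "\<not> 0 \<le> s l"
    moreover have "continuous_on {l/2..l} s"
      using sol_cont(1)[OF s] by (rule continuous_on_subset) (use l in auto)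
    ultimately obtain t where t: "l / 2 \<le> t" "t \<le> l" "s t = s l / 2"
      \<comment> \<open>Half the negative end value is still negative but differs from
        \<open>s l\<close>, so it is attained strictly inside, where \<open>s\<close> is
        nonnegative.\<close>
      using IVT2'[of s l "s l / 2" "l / 2"] nonneg[of "l / 2"] l by auto
    then show False using nonneg[of t] \<open>\<not> 0 \<le> s l\<close> l by (cases "t = l") auto
  qed
  then have nonneg': "0 \<le> s x" if "x \<in> {0<..l}" for x using nonneg[of x] that by (cases "x = l") auto
  show ?thesis
  proof (cases "x = l")
    case True
    then show ?thesis using wr[of l] ul nonneg'[of l] l by (cases "s l = 0") auto
  next
    case False
    then show ?thesis using sol_pos_interior[OF s _ nonneg', of x] s0 x by auto
  qed
qed

text \<open>
  The test function \<open>f x = sin (\<kappa> x) u x\<close> in the Rayleigh quotient of the odd subspace. The function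
  \<open>H\<close> integrates Picone's identity for \<open>f\<close> and \<open>s\<close>, plus the term \<open>\<kappa> sin cos u\<^sup>2\<close> whose derivative
  replaces \<open>cos\<^sup>2\<close> by \<open>3 sin\<^sup>2\<close> up to a multiple of the nonnegative cosine Wronskian of \<open>u\<close>.
\<close>
lemma odd_sol_pos_imp_energy_le:
  assumes u: "sol E0 u p" and u0: "u 0 = 1" "p 0 = 0" and ul: "u l = 0"
    and upos: "\<And>x. x \<in> {0..<l} \<Longrightarrow> 0 < u x"
    and s: "sol E s r" and s0: "s 0 = 0" "r 0 = 1" and spos: "\<And>x. x \<in> {0<..l} \<Longrightarrow> 0 < s x"
  shows "E \<le> E0 + 3 * \<kappa>\<^sup>2"
proof (rule ccontr)
  assume E: "\<not> E \<le> E0 + 3 * \<kappa>\<^sup>2"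
  \<comment> \<open>The logarithmic derivative of \<open>s\<close>, which satisfies the Riccati
    equation \<open>h' = v - E - h\<^sup>2\<close>.\<close>
  define h where "h x = r x / s x" for x
  have hder: "(h has_real_derivative (v x - E) - (h x)\<^sup>2) (at x)" if x: "x \<in> {0<..<l} - N" for x
  proof -
    have "s x \<noteq> 0" using spos[of x] x by auto
    then show ?thesis unfolding h_def
      using sol_deriv[OF s, of x] sol_deriv2[OF s x] x
      by (auto intro!: derivative_eq_intros simp: field_simps power2_eq_square)
  qed
  let ?S = "\<lambda>x. sin (\<kappa> * x)" and ?C = "\<lambda>x. cos (\<kappa> * x)"
  let ?W = "\<lambda>x. p x * cos (\<kappa> * x) + \<kappa> * u x * sin (\<kappa> * x)"
  let ?H = "\<lambda>x. (?S x)\<^sup>2 * u x * p x - (?S x)\<^sup>2 * (u x)\<^sup>2 * h x + \<kappa> * ?S x * ?C x * (u x)\<^sup>2"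
  \<comment> \<open>The square is Picone's remainder \<open>(f' - f * h)\<^sup>2\<close> for
    \<open>f = ?S * u\<close>. The derivative of the added term contributes
    \<open>- \<kappa>\<^sup>2 * f\<^sup>2\<close>, and rewriting the leftover
    \<open>2 * \<kappa> * ?S * ?C * u * p\<close> through \<open>?W\<close> costs another
    \<open>2 * \<kappa>\<^sup>2 * f\<^sup>2\<close>; this is the origin of the 3.\<close>
  let ?G = "\<lambda>x. (E - E0 - 3 * \<kappa>\<^sup>2) * (?S x * u x)\<^sup>2 + 2 * \<kappa> * (?S x * u x * ?W x)
      + (\<kappa> * ?C x * u x + ?S x * p x - ?S x * u x * h x)\<^sup>2"
  have unonneg: "0 \<le> u x" if "x \<in> {0..l}" for x using upos[of x] ul that by (cases "x = l") auto
  have hc: "continuous_on {0..l} (\<lambda>x. (?S x)\<^sup>2 * (u x)\<^sup>2 * h x)"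
    unfolding continuous_on_def
  proof
    fix x assume x: "x \<in> {0..l}"
    show "((\<lambda>x. (?S x)\<^sup>2 * (u x)\<^sup>2 * h x) \<longlongrightarrow> (?S x)\<^sup>2 * (u x)\<^sup>2 * h x) (at x within {0..l})"
    proof (cases "x = 0")
      case False
      then have "s x \<noteq> 0" using spos[of x] x by auto
      then show ?thesis unfolding h_def
        using sol_cont[OF s] sol_cont(1)[OF u] x unfolding continuous_on_def
        by (intro tendsto_intros) auto
    next
      case True
      \<comment> \<open>\<open>h\<close> has a pole at 0, where division by zero gives it the value
        0. The double zero of the squared sine compensates: \<open>?S / s\<close> tends to
        \<open>\<kappa>\<close>, and one factor \<open>?S\<close> remains.\<close>
      have "((\<lambda>x. ?S x / (x - 0)) \<longlongrightarrow> \<kappa>) (at 0 within {0..l})"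
      proof -
        have "(?S has_real_derivative \<kappa>) (at 0 within {0..l})"
          by (auto intro!: derivative_eq_intros)
        then show ?thesis by (simp add: has_field_derivative_iff)
      qed
      moreover have "((\<lambda>x. s x / (x - 0)) \<longlongrightarrow> 1) (at 0 within {0..l})"
      proof -
        have "(s has_real_derivative r 0) (at 0 within {0..l})" using s l by (auto simp: sol_def)
        then show ?thesis by (simp add: has_field_derivative_iff s0)
      qed
      ultimately have "((\<lambda>x. (?S x / (x - 0)) / (s x / (x - 0))) \<longlongrightarrow> \<kappa> / 1) (at 0 within {0..l})"
        by (rule tendsto_divide) simp
      then have quot: "((\<lambda>x. ?S x / s x) \<longlongrightarrow> \<kappa> / 1) (at 0 within {0..l})"
        by (rule Lim_transform_eventually) (auto simp: eventually_at_filter)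
      have "(r \<longlongrightarrow> r 0) (at 0 within {0..l})"
        "(u \<longlongrightarrow> u 0) (at 0 within {0..l})"
        using sol_cont[OF s] sol_cont(1)[OF u] l unfolding continuous_on_def by auto
      then have "((\<lambda>x. ?S x * (?S x / s x) * (u x)\<^sup>2 * r x) \<longlongrightarrow> sin (\<kappa> * 0) * (\<kappa> / 1) * (u 0)\<^sup>2 * r 0)
          (at 0 within {0..l})"
        by (intro tendsto_mult tendsto_power quot tendsto_sin tendsto_const tendsto_ident_at)
      then show ?thesis using True by (simp add: h_def power2_eq_square mult_ac)
    qed
  qed
  have "continuous_on {0..l} ?H"
    by (intro continuous_on_add continuous_on_diff hc) (intro continuous_intros sol_cont[OF u])+
  moreover have "?H l \<le> ?H 0" using ul by simp
  moreover have "(?H has_real_derivative ?G x) (at x)" if x: "x \<in> {0<..<l} - N" for x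
    using sol_deriv[OF u, of x] sol_deriv2[OF u x] hder[OF x] x
    by (auto intro!: derivative_eq_intros simp: algebra_simps power2_eq_square)
  moreover have G: "0 < ?G x" if x: "x \<in> {0<..<l} - N" for x
  proof -
    have "0 < ?S x" "0 < u x" using sin_kappa_pos[of x] upos[of x] x by auto
    moreover have "0 \<le> ?W x" using cos_wronskian_nonneg[OF u u0(2) ul unonneg, of x] x by auto
    ultimately have "0 < (E - E0 - 3 * \<kappa>\<^sup>2) * (?S x * u x)\<^sup>2" "0 \<le> 2 * \<kappa> * (?S x * u x * ?W x)"
      using E kappa_pos by simp_all
    then show ?thesis using zero_le_power2[of "\<kappa> * ?C x * u x + ?S x * p x - ?S x * u x * h x"]
      by linarith
  qed
  ultimately obtain x where "x \<in> {0<..<l} - N" "?G x = 0"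
    using deriv_vanishes_somewhere[of ?H ?G] by (metis (no_types, lifting) less_imp_le)
  then show False using G[of x] by simp
qed

text \<open>Picone's identity with the positive function \<open>w\<close>: \<open>?F\<close> equals
  \<open>y * p - y\<^sup>2 * \<omega> / w\<close> and vanishes at both ends, so
  \<open>E' > E\<close> would force a double zero of \<open>y\<close>. The condition
  \<open>y 0 * p 0 = 0\<close> covers even and odd solutions at once.\<close>

lemma eigen_energy_ge:
  assumes w: "sol E' w \<omega>" and w0: "\<omega> 0 = 0" and wpos: "\<And>x. x \<in> {0..l} \<Longrightarrow> 0 < w x"
    and y: "sol E y p" and yl: "y l = 0" and y0: "y 0 * p 0 = 0" and nt: "y 0 \<noteq> 0 \<or> p 0 \<noteq> 0"
  shows "E' \<le> E"
proof (rule ccontr)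
  assume less: "\<not> E' \<le> E"
  let ?Z = "\<lambda>x. w x * p x - y x * \<omega> x"
  let ?F = "\<lambda>x. ?Z x * y x / w x"
  let ?G = "\<lambda>x. (E' - E) * (y x)\<^sup>2 + (?Z x / w x)\<^sup>2"
  obtain x where x: "x \<in> {0<..<l} - N" "?G x = 0"
  proof (rule deriv_vanishes_somewhere[of ?F ?G])
    have "w x \<noteq> 0" if "x \<in> {0..l}" for x using wpos[OF that] by simp
    then show "continuous_on {0..l} ?F"
      by (intro continuous_intros sol_cont[OF w] sol_cont[OF y]) auto
    show "?F l \<le> ?F 0" using yl y0 w0 by (auto simp: mult.commute)
    fix x assume x: "x \<in> {0<..<l} - N"
    then have "w x \<noteq> 0" using wpos[of x] by simp
    then show "(?F has_real_derivative ?G x) (at x)"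
      using sol_deriv2[OF w x] sol_deriv2[OF y x] sol_deriv[OF w, of x] sol_deriv[OF y, of x] x
      by (auto intro!: derivative_eq_intros simp: field_simps power2_eq_square)
    show "0 \<le> ?G x" using less by simp
  qed
  have wx: "w x \<noteq> 0" using wpos[of x] x by simp
  have "0 \<le> (E' - E) * (y x)\<^sup>2" "0 \<le> (?Z x / w x)\<^sup>2" using less by simp_all
  then have "(E' - E) * (y x)\<^sup>2 = 0" "(?Z x / w x)\<^sup>2 = 0" using x(2) by linarith+
  then have "y x = 0" "?Z x = 0" using less wx by simp_all
  then have "y x = 0" "p x = 0" using wx by simp_all
  then show False using sol_no_double_zero[OF y, of x] x nt by auto
qed

end

section \<open>The Dirichlet eigenvalues\<close>

lemma has_ac_derivative_on_continuous:
  assumes "has_ac_derivative_on f g a b"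
  shows "continuous_on {a..b} f"
proof -
  have "g integrable_on {a..b}"
    using assms by (auto simp: has_ac_derivative_on_def intro: set_lebesgue_integral_eq_integral(1))
  then have "continuous_on {a..b} (\<lambda>x. f a + integral {a..x} g)"
    by (intro continuous_intros indefinite_integral_continuous_1)
  then show ?thesis
    by (rule continuous_on_eq) (metis assms has_ac_derivative_on_def)
qed

text \<open>The difference of \<open>F\<close> and the indefinite integral of \<open>G\<close> has
  derivative 0 off a countable set, so it is constant.\<close>

lemma has_ac_derivative_onI:
  fixes F G :: "real \<Rightarrow> real"
  assumes "continuous_on {a..b} F" and G: "G absolutely_integrable_on {a..b}" and K: "countable K"
    and der: "\<And>x. x \<in> {a<..<b} - K \<Longrightarrow> (F has_real_derivative G x) (at x) \<and> isCont G x"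
    and f: "\<And>x. x \<in> {a..b} \<Longrightarrow> f x = complex_of_real (F x)"
  shows "has_ac_derivative_on f (\<lambda>x. complex_of_real (G x)) a b"
proof -
  have Gint: "G integrable_on {a..b}" using G by (rule set_lebesgue_integral_eq_integral(1))
  have F: "F x = F a + integral {a..x} G" if x: "x \<in> {a..b}" for x
  proof -
    have "F a - integral {a..a} G = F x - integral {a..x} G"
    proof (rule constant_off_countable[where F = "\<lambda>x. F x - integral {a..x} G", OF _ K])
      show "continuous_on {a..x} (\<lambda>x. F x - integral {a..x} G)"
        by (rule continuous_on_subset[of "{a..b}"])
           (use assms(1) x in \<open>auto intro!: continuous_intros indefinite_integral_continuous_1[OF Gint]\<close>)
      fix t assume t: "t \<in> {a<..<x} - K"
      then have t': "t \<in> {a<..<b} - K" using x by auto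
      have "((\<lambda>u. integral {a..u} G) has_vector_derivative G t) (at t within ({a..b} - {}))"
        using der[OF t'] t'
        by (intro integral_has_vector_derivative_continuous_at[OF Gint])
           (auto intro: continuous_at_imp_continuous_at_within)
      then have "((\<lambda>u. integral {a..u} G) has_real_derivative G t) (at t)"
        using t' by (simp add: at_within_Icc_at has_real_derivative_iff_has_vector_derivative)
      then show "((\<lambda>x. F x - integral {a..x} G) has_real_derivative 0) (at t)"
        using der[OF t'] by (auto intro!: derivative_eq_intros)
    qed (use x in auto)
    then show ?thesis by simp
  qed
  have "(\<lambda>x. complex_of_real (G x)) absolutely_integrable_on {a..b}"
    using absolutely_integrable_linear[OF G bounded_linear_of_real] by (simp add: o_def)
  moreover have "f x = f a + integral {a..x} (\<lambda>x. complex_of_real (G x))" if x: "x \<in> {a..b}" for x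
  proof -
    have "G integrable_on {a..x}"
      using Gint by (rule integrable_on_subinterval) (use x in auto)
    then have "integral {a..x} (complex_of_real \<circ> G) = complex_of_real (integral {a..x} G)"
      by (rule integral_linear) (rule bounded_linear_of_real)
    then show ?thesis using F[OF x] f[of x] f[of a] x by (simp add: o_def)
  qed
  ultimately show ?thesis unfolding has_ac_derivative_on_def by blast
qed

lemma square_integrable_on_bounded_times_continuous:
  fixes q Y :: "real \<Rightarrow> real"
  assumes q: "q \<in> borel_measurable lebesgue" "\<And>x. \<bar>q x\<bar> \<le> K" and Y: "continuous_on {a..b} Y"
    and f: "\<And>x. x \<in> {a<..<b} \<Longrightarrow> f x = complex_of_real (q x * Y x)"
  shows "square_integrable_on f {a<..<b}"
proof -
  obtain B where B: "\<forall>x\<in>{a..b}. \<bar>Y x\<bar> \<le> B"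
    using compact_imp_bounded[OF compact_continuous_image[OF Y compact_Icc]]
    by (auto simp: bounded_iff)
  have "continuous_on {a<..<b} Y" by (rule continuous_on_subset[OF Y]) auto
  then have "Y \<in> borel_measurable (lebesgue_on {a<..<b})"
    by (intro continuous_imp_measurable_on_sets_lebesgue) auto
  moreover have "q \<in> borel_measurable (lebesgue_on {a<..<b})"
    using q(1) by (rule measurable_restrict_space1)
  ultimately have "(\<lambda>x. complex_of_real (q x * Y x)) \<in> borel_measurable (lebesgue_on {a<..<b})"
    by measurable
  then have fm: "f \<in> borel_measurable (lebesgue_on {a<..<b})"
    by (subst measurable_cong[where g = "\<lambda>x. complex_of_real (q x * Y x)"]) (auto simp: f)
  have "integrable (lebesgue_on {a<..<b}) (\<lambda>x. (cmod (f x))\<^sup>2)"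
  proof (rule measurable_bounded_by_integrable_imp_lebesgue_integrable)
    show "(\<lambda>x. (cmod (f x))\<^sup>2) \<in> borel_measurable (lebesgue_on {a<..<b})"
      using fm by measurable
    show "integrable (lebesgue_on {a<..<b}) (\<lambda>x. (K * B)\<^sup>2)"
      by (rule finite_measure.integrable_const) (rule finite_measure_lebesgue_on, simp)
    fix x assume x: "x \<in> {a<..<b}"
    have "\<bar>q x * Y x\<bar> \<le> K * B"
      unfolding abs_mult using q(2)[of x] B x by (intro mult_mono) auto
    then have "\<bar>q x * Y x\<bar>\<^sup>2 \<le> (K * B)\<^sup>2" by (intro power_mono) auto
    then show "norm ((cmod (f x))\<^sup>2) \<le> (K * B)\<^sup>2" using f[OF x] by (simp add: norm_mult abs_mult)
  qed simp
  with fm show ?thesis by (simp add: square_integrable_on_def)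
qed

text \<open>\<open>dim\<close> is the \<open>card\<close> of a basis, and \<open>card\<close> is 0
  on infinite sets; a nonzero vector makes it positive only together with finite dimension.\<close>

lemma (in vector_space) dim_pos_if_finite_span:
  assumes "finite B" "V \<subseteq> span B" "x \<in> V" "x \<noteq> 0"
  shows "0 < dim V"
proof -
  obtain A where A: "A \<subseteq> V" "independent A" "V \<subseteq> span A" "card A = dim V" by (rule basis_exists)
  have "finite A" using independent_span_bound[OF assms(1) A(2)] A(1) assms(2) by auto
  moreover have "A \<noteq> {}" using A(3) assms(3,4) by auto
  ultimately show ?thesis using A(4) card_gt_0_iff by metis
qed

lemma isCont_minus_even:
  fixes v :: "real \<Rightarrow> real"
  assumes even: "\<And>x. v (- x) = v x" and "isCont v x"
  shows "isCont v (- x)"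
proof -
  have "isCont (\<lambda>t. v (- t)) (- x)" using assms(2) by (intro isCont_o2[of "- x" uminus v]) auto
  then show ?thesis by (simp add: even)
qed

section \<open>Eigenfunctions as pairs of solutions on the half interval\<close>

context symmetric_barrier begin

text \<open>The almost-everywhere equation may be substituted under the integral that represents
  \<open>f'\<close>; at continuity points of \<open>v\<close> the new integrand is continuous, so
  \<open>f'\<close> is differentiable there.\<close>

lemma eigenfunction_classical:
  assumes "f \<in> eigenspace v (2 * l) E"
  obtains f' where "f l = 0" "f (- l) = 0" "\<And>x. l \<le> \<bar>x\<bar> \<Longrightarrow> f x = 0"
    "continuous_on {- l..l} f'"
    "\<And>x. x \<in> {- l..l} \<Longrightarrow> (f has_vector_derivative f' x) (at x within {- l..l})"
    "\<And>x. x \<in> {- l<..<l} \<Longrightarrow> isCont v x \<Longrightarrow>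
       (f' has_vector_derivative complex_of_real (v x - E) * f x) (at x)"
proof -
  have zero: "f x = 0" if "x \<notin> {- l<..<l}" for x
    using assms that by (auto simp: eigenspace_def dirichlet_schroedinger_def)
  have half: "2 * l / 2 = l" "- (2 * l) / 2 = - l" by simp_all
  obtain f' f'' where f: "has_ac_derivative_on f f' (- l) l" "has_ac_derivative_on f' f'' (- l) l"
    and ae: "AE x in lebesgue_on {- l<..<l}. of_real E * f x = - f'' x + of_real (v x) * f x"
    using assms unfolding eigenspace_def dirichlet_schroedinger_def mem_Collect_eq half by blast
  have fc: "continuous_on {- l..l} f" and f'c: "continuous_on {- l..l} f'"
    using f[THEN has_ac_derivative_on_continuous] by auto
  let ?g = "\<lambda>x. complex_of_real (v x - E) * f x"
  have fint: "f x = f (- l) + integral {- l..x} f'" if "x \<in> {- l..l}" for x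
    using f(1) that unfolding has_ac_derivative_on_def by blast
  have d1: "(f has_vector_derivative f' x) (at x within {- l..l})" if x: "x \<in> {- l..l}" for x
  proof -
    have "((\<lambda>u. f (- l) + integral {- l..u} f') has_vector_derivative 0 + f' x) (at x within {- l..l})"
      by (intro has_vector_derivative_add has_vector_derivative_const integral_has_vector_derivative f'c x)
    then have "((\<lambda>u. f (- l) + integral {- l..u} f') has_vector_derivative f' x) (at x within {- l..l})"
      by simp
    then show ?thesis
      by (rule has_vector_derivative_transform[OF x fint, rotated -1])
  qed
  have "AE x in lebesgue. x \<in> {- l<..<l} \<longrightarrow> of_real E * f x = - f'' x + of_real (v x) * f x"
    using ae by (subst (asm) AE_restrict_space_iff) auto
  then have "negligible {x. \<not> (x \<in> {- l<..<l} \<longrightarrow> of_real E * f x = - f'' x + of_real (v x) * f x)}" (is "negligible ?Z")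
    unfolding eventually_ae_filter_negligible by (metis negligible_subset)
  \<comment> \<open>The end points join the null set because the equation is stated on the open
    interval only.\<close>
  then have neg: "negligible (?Z \<union> {- l, l})" by simp
  have spike: "?g x = f'' x" if "x \<in> {- l..l} - (?Z \<union> {- l, l})" for x
    using that by (auto simp: algebra_simps)
  have gint: "?g integrable_on {- l..l}"
    by (rule integrable_spike[OF _ neg spike])
       (use f(2) in \<open>auto simp: has_ac_derivative_on_def intro: set_lebesgue_integral_eq_integral(1)\<close>)
  have f'int: "f' x = f' (- l) + integral {- l..x} ?g" if "x \<in> {- l..l}" for x
  proof -
    have "integral {- l..x} ?g = integral {- l..x} f''"
      by (rule integral_spike[OF neg]) (use spike that in auto)
    moreover have "f' x = f' (- l) + integral {- l..x} f''"
      using f(2) that unfolding has_ac_derivative_on_def by blast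
    ultimately show ?thesis by simp
  qed
  have d2: "(f' has_vector_derivative ?g x) (at x)" if x: "x \<in> {- l<..<l}" and c: "isCont v x" for x
  proof -
    have "isCont f x" using fc x
      by (metis at_within_Icc_at continuous_on_eq_continuous_within greaterThanLessThan_iff
          atLeastAtMost_iff less_imp_le)
    then have "isCont ?g x" using c by (intro continuous_intros) auto
    then have "((\<lambda>u. integral {- l..u} ?g) has_vector_derivative ?g x) (at x within ({- l..l} - {}))"
      using x by (intro integral_has_vector_derivative_continuous_at[OF gint])
         (auto intro: continuous_at_imp_continuous_at_within)
    then have "((\<lambda>u. f' (- l) + integral {- l..u} ?g) has_vector_derivative 0 + ?g x) (at x within {- l..l})"
      by (intro has_vector_derivative_add has_vector_derivative_const) simp
    then have "((\<lambda>u. f' (- l) + integral {- l..u} ?g) has_vector_derivative ?g x) (at x within {- l..l})"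
      by simp
    then have "(f' has_vector_derivative ?g x) (at x within {- l..l})"
      by (rule has_vector_derivative_transform[OF _ f'int, rotated -1]) (use x in auto)
    then show ?thesis using x by (simp add: at_within_Icc_at)
  qed
  show thesis
  proof (rule that[OF _ _ _ f'c d1 d2])
    show "f x = 0" if "l \<le> \<bar>x\<bar>" for x using zero[of x] that by (simp add: abs_le_iff) linarith
  qed (use zero in simp_all)
qed

text \<open>To be used with \<open>h\<close> the real or imaginary part;
  \<open>\<sigma> = - 1\<close> reflects the left half of the interval onto the right one, where
  evenness of \<open>v\<close> restores the same equation.\<close>

lemma eigenfunction_component_sol:
  assumes h: "bounded_linear h" and hr: "\<And>c z. h (complex_of_real c * z) = c * (h z :: real)"
    and sg: "\<sigma> = 1 \<or> \<sigma> = - 1"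
    and f'c: "continuous_on {- l..l} f'"
    and d1: "\<And>x. x \<in> {- l..l} \<Longrightarrow> (f has_vector_derivative f' x) (at x within {- l..l})"
    and d2: "\<And>x. x \<in> {- l<..<l} \<Longrightarrow> isCont v x \<Longrightarrow>
       (f' has_vector_derivative complex_of_real (v x - E) * f x) (at x)"
  shows "sol E (\<lambda>t. h (f (\<sigma> * t))) (\<lambda>t. \<sigma> * h (f' (\<sigma> * t)))"
  unfolding sol_def
proof (intro conjI ballI)
  have range: "\<sigma> * t \<in> {- l..l}" if "t \<in> {0..l}" for t using that sg by auto
  have lin: "((\<lambda>t. \<sigma> * t) has_vector_derivative \<sigma>) (at t within S)" for t S
    unfolding has_real_derivative_iff_has_vector_derivative[symmetric]
    by (auto intro!: derivative_eq_intros)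
  fix t assume t: "t \<in> {0..l}"
  have "(f has_vector_derivative f' (\<sigma> * t)) (at (\<sigma> * t) within (\<lambda>t. \<sigma> * t) ` {0..l})"
    using d1[OF range[OF t]] by (rule has_vector_derivative_within_subset) (use range in auto)
  from vector_diff_chain_within[OF lin this]
  have "((f \<circ> (\<lambda>t. \<sigma> * t)) has_vector_derivative \<sigma> *\<^sub>R f' (\<sigma> * t)) (at t within {0..l})" .
  from bounded_linear.has_vector_derivative[OF h this]
  show "((\<lambda>t. h (f (\<sigma> * t))) has_real_derivative \<sigma> * h (f' (\<sigma> * t))) (at t within {0..l})"
    by (simp add: has_real_derivative_iff_has_vector_derivative linear_cmul[OF bounded_linear.linear[OF h]])
next
  have "continuous_on {0..l} (\<lambda>t. f' (\<sigma> * t))"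
    by (rule continuous_on_compose2[OF f'c]) (use sg in \<open>auto intro!: continuous_intros\<close>)
  then show "continuous_on {0..l} (\<lambda>t. \<sigma> * h (f' (\<sigma> * t)))"
    by (intro continuous_intros bounded_linear.continuous_on[OF h])
next
  have lin: "((\<lambda>t. \<sigma> * t) has_vector_derivative \<sigma>) (at t)" for t
    unfolding has_real_derivative_iff_has_vector_derivative[symmetric]
    by (auto intro!: derivative_eq_intros)
  fix t assume t: "t \<in> {0<..<l} - N"
  then have "isCont v (\<sigma> * t)" using sg v_cont[of t] isCont_minus_even[of v t, OF v_even] by auto
  moreover have "\<sigma> * t \<in> {- l<..<l}" using t sg by auto
  ultimately have "(f' has_vector_derivative complex_of_real (v (\<sigma> * t) - E) * f (\<sigma> * t)) (at (\<sigma> * t))"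
    by (intro d2)
  from vector_diff_chain_at[OF lin this]
  have "((f' \<circ> (\<lambda>t. \<sigma> * t)) has_vector_derivative
      \<sigma> *\<^sub>R (complex_of_real (v (\<sigma> * t) - E) * f (\<sigma> * t))) (at t)" .
  from bounded_linear.has_vector_derivative[OF h this]
  have "((\<lambda>t. h (f' (\<sigma> * t))) has_real_derivative \<sigma> * ((v (\<sigma> * t) - E) * h (f (\<sigma> * t)))) (at t)"
    by (simp add: has_real_derivative_iff_has_vector_derivative linear_cmul[OF bounded_linear.linear[OF h]] hr
        del: of_real_diff)
  then have "((\<lambda>t. \<sigma> * h (f' (\<sigma> * t))) has_real_derivative
      \<sigma> * (\<sigma> * ((v (\<sigma> * t) - E) * h (f (\<sigma> * t))))) (at t)"
    by (rule DERIV_cmult)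
  moreover have "\<sigma> * (\<sigma> * ((v (\<sigma> * t) - E) * h (f (\<sigma> * t)))) = (v t - E) * h (f (\<sigma> * t))"
    using sg by (auto simp: v_even)
  ultimately show "((\<lambda>t. \<sigma> * h (f' (\<sigma> * t))) has_real_derivative (v t - E) * h (f (\<sigma> * t))) (at t)"
    by simp
qed

text \<open>Cramer's rule: the coefficients are Wronskians of \<open>y\<close> with \<open>s\<close>
  and \<open>c\<close>, and the determinant is the Wronskian of \<open>c\<close> and
  \<open>s\<close>, which is 1.\<close>

lemma sol_decompose:
  assumes y: "sol E y p" and c: "sol E c c'" "c 0 = 1" "c' 0 = 0"
    and s: "sol E s s'" "s 0 = 0" "s' 0 = 1" and x: "x \<in> {0..l}"
  shows "y x = y 0 * c x + p 0 * s x"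
proof -
  have "c x * s' x - s x * c' x = 1" "y x * s' x - s x * p x = y 0" "c x * p x - y x * c' x = p 0"
    using wronskian_const[OF c(1) s(1) x] wronskian_const[OF y s(1) x] wronskian_const[OF c(1) y x] c s
    by auto
  then show ?thesis by algebra
qed

text \<open>The split into even and odd parts: \<open>a = f 0\<close> and \<open>b = f' 0\<close>
  serve both halves, only the sign of \<open>b\<close> changes under reflection.\<close>

lemma eigenfunction_decompose:
  assumes f: "f \<in> eigenspace v (2 * l) E" and c: "sol E c c'" "c 0 = 1" "c' 0 = 0"
    and s: "sol E s s'" "s 0 = 0" "s' 0 = 1"
  obtains a b where "\<And>x. x \<in> {0..l} \<Longrightarrow> f x = a * of_real (c x) + b * of_real (s x)"
    "\<And>x. x \<in> {0..l} \<Longrightarrow> f (- x) = a * of_real (c x) - b * of_real (s x)"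
    "f l = 0" "f (- l) = 0" "\<And>x. l \<le> \<bar>x\<bar> \<Longrightarrow> f x = 0"
proof -
  obtain f' where f': "f l = 0" "f (- l) = 0" "\<And>x. l \<le> \<bar>x\<bar> \<Longrightarrow> f x = 0"
    "continuous_on {- l..l} f'"
    "\<And>x. x \<in> {- l..l} \<Longrightarrow> (f has_vector_derivative f' x) (at x within {- l..l})"
    "\<And>x. x \<in> {- l<..<l} \<Longrightarrow> isCont v x \<Longrightarrow>
       (f' has_vector_derivative complex_of_real (v x - E) * f x) (at x)"
    using eigenfunction_classical[OF f] by blast
  have comp: "h (f (\<sigma> * x)) = h (f 0) * c x + \<sigma> * h (f' 0) * s x"
    if "bounded_linear h" "\<And>c z. h (complex_of_real c * z) = c * (h z :: real)"
      "\<sigma> = 1 \<or> \<sigma> = - 1" "x \<in> {0..l}" for h \<sigma> x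
    using sol_decompose[OF eigenfunction_component_sol[OF that(1-3) f'(4-6)] c s that(4)] by simp
  have ReIm: "f (\<sigma> * x) = f 0 * of_real (c x) + of_real \<sigma> * f' 0 * of_real (s x)"
    if "\<sigma> = 1 \<or> \<sigma> = - 1" "x \<in> {0..l}" for \<sigma> x
    using comp[OF bounded_linear_Re _ that] comp[OF bounded_linear_Im _ that] by (intro complex_eqI) auto
  show thesis
  proof (rule that[of "f 0" "f' 0"])
    fix x assume x: "x \<in> {0..l}"
    show "f x = f 0 * of_real (c x) + f' 0 * of_real (s x)" using ReIm[of 1, OF _ x] by simp
    show "f (- x) = f 0 * of_real (c x) - f' 0 * of_real (s x)" using ReIm[of "- 1", OF _ x] by simp
  qed (fact f')+
qed

text \<open>\<open>\<sigma>\<close> is the parity, 1 for even and \<open>- 1\<close> for odd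
  reflection. The cut-off matches the operator domain, whose functions vanish outside the open
  interval.\<close>

definition extend :: "real \<Rightarrow> (real \<Rightarrow> real) \<Rightarrow> real \<Rightarrow> complex" where
  "extend \<sigma> y x = (if \<bar>x\<bar> < l then of_real (if 0 \<le> x then y x else \<sigma> * y (- x)) else 0)"

text \<open>Gives finite dimension, without which a multiplicity could not be shown
  positive.\<close>

lemma eigenspace_subset_span:
  assumes c: "sol E c c'" "c 0 = 1" "c' 0 = 0" and s: "sol E s s'" "s 0 = 0" "s' 0 = 1"
  shows "eigenspace v (2 * l) E \<subseteq> cfun.span {extend 1 c, extend (- 1) s}"
proof
  fix f assume "f \<in> eigenspace v (2 * l) E"
  then obtain a b where ab: "\<And>x. x \<in> {0..l} \<Longrightarrow> f x = a * of_real (c x) + b * of_real (s x)"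
    "\<And>x. x \<in> {0..l} \<Longrightarrow> f (- x) = a * of_real (c x) - b * of_real (s x)" "\<And>x. l \<le> \<bar>x\<bar> \<Longrightarrow> f x = 0"
    using eigenfunction_decompose[OF _ c s] by metis
  have "f = (\<lambda>x. a * extend 1 c x) + (\<lambda>x. b * extend (- 1) s x)"
  proof
    fix x
    consider "l \<le> \<bar>x\<bar>" | "\<bar>x\<bar> < l" "0 \<le> x" | "\<bar>x\<bar> < l" "x < 0" by linarith
    then show "f x = ((\<lambda>x. a * extend 1 c x) + (\<lambda>x. b * extend (- 1) s x)) x"
    proof cases
      case 3
      then show ?thesis using ab(2)[of "- x"] by (simp add: extend_def)
    qed (use ab in \<open>auto simp: extend_def\<close>)
  qed
  also have "\<dots> \<in> cfun.span {extend 1 c, extend (- 1) s}"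
    by (rule cfun.span_add[OF cfun.span_scale[OF cfun.span_base] cfun.span_scale[OF cfun.span_base]]) auto
  finally show "f \<in> cfun.span {extend 1 c, extend (- 1) s}" .
qed

text \<open>The boundary values at \<open>l\<close> and \<open>- l\<close> separate the parities, so
  \<open>c\<close> or \<open>s\<close> satisfies the Dirichlet condition at \<open>l\<close> and
  \<open>eigen_energy_ge\<close> applies to it.\<close>

lemma eigen_energy_ge_shoot:
  assumes f: "f \<in> eigenspace v (2 * l) E" "f \<noteq> 0" and pos: "shoot_pos 1 0 E'"
  shows "E' \<le> E"
proof -
  obtain c c' where c: "sol E c c'" "c 0 = 1" "c' 0 = 0" using sol_exists by blast
  obtain s s' where s: "sol E s s'" "s 0 = 0" "s' 0 = 1" using sol_exists by blast
  obtain a b where ab: "\<And>x. x \<in> {0..l} \<Longrightarrow> f x = a * of_real (c x) + b * of_real (s x)"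
    "\<And>x. x \<in> {0..l} \<Longrightarrow> f (- x) = a * of_real (c x) - b * of_real (s x)"
    "f l = 0" "f (- l) = 0" "\<And>x. l \<le> \<bar>x\<bar> \<Longrightarrow> f x = 0"
    using eigenfunction_decompose[OF f(1) c s] by metis
  have "a * of_real (c l) + b * of_real (s l) = 0" "a * of_real (c l) - b * of_real (s l) = 0"
    using ab(1,2)[of l] ab(3,4) l by auto
  then have ends: "a * of_real (c l) = 0" "b * of_real (s l) = 0" by algebra+
  have "a \<noteq> 0 \<or> b \<noteq> 0"
  proof (rule ccontr)
    assume "\<not> (a \<noteq> 0 \<or> b \<noteq> 0)"
    then have "f x = 0" for x
      using ab(1)[of x] ab(2)[of "- x"] ab(5)[of x] by (cases "0 \<le> x"; cases "\<bar>x\<bar> \<le> l") auto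
    then show False using f(2) by auto
  qed
  then have "c l = 0 \<or> s l = 0" using ends by auto
  let ?w = "fst (shoot 1 0 E')"
  have wpos: "0 < ?w x" if "x \<in> {0..l}" for x
    using pos shoot(2)[of 1 0 E'] that by (cases "x = 0") (auto simp: shoot_pos_def)
  from \<open>c l = 0 \<or> s l = 0\<close> show ?thesis
    using eigen_energy_ge[OF shoot(1) shoot(3) wpos c(1)] eigen_energy_ge[OF shoot(1) shoot(3) wpos s(1)] c s
    by auto
qed

section \<open>Extending half-interval solutions to eigenfunctions\<close>

lemma continuous_on_reflected:
  fixes h :: "real \<Rightarrow> real"
  assumes h: "continuous_on {0..l} h" and "h 0 = \<tau> * h 0"
  shows "continuous_on {- l..l} (\<lambda>x. if 0 \<le> x then h x else \<tau> * h (- x))"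
proof -
  have "continuous_on ({0..l} \<union> {- l..0}) (\<lambda>x. if 0 \<le> x then h x else \<tau> * h (- x))"
  proof (rule continuous_on_If)
    have "continuous_on {- l..0} (\<lambda>x. h (- x))"
      by (rule continuous_on_compose2[OF h]) (auto intro!: continuous_intros)
    then show "continuous_on {- l..0} (\<lambda>x. \<tau> * h (- x))" by (intro continuous_intros)
    show "h x = \<tau> * h (- x)" if "x \<in> {- l..0}" "0 \<le> x" for x
    proof -
      have "x = 0" using that by simp
      then show ?thesis using assms(2) by simp
    qed
  qed (use h in auto)
  moreover have "{0..l} \<union> {- l..0} = {- l..l}" using l by auto
  ultimately show ?thesis by simp
qed

text \<open>The parity condition is what glues at 0: an even extension needs \<open>p 0 = 0\<close>
  for a continuous derivative, an odd one needs \<open>y 0 = 0\<close> to be continuous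
  itself.\<close>

lemma extend_in_eigenspace:
  assumes y: "sol E y p" and yl: "y l = 0" and par: "\<sigma> = 1 \<and> p 0 = 0 \<or> \<sigma> = - 1 \<and> y 0 = 0"
  shows "extend \<sigma> y \<in> eigenspace v (2 * l) E"
proof -
  have half: "2 * l / 2 = l" "- (2 * l) / 2 = - l" by simp_all
  define Y where "Y x = (if 0 \<le> x then y x else \<sigma> * y (- x))" for x
  \<comment> \<open>Differentiation reverses parity, hence the sign in
    \<open>- \<sigma>\<close>.\<close>
  define P where "P x = (if 0 \<le> x then p x else - \<sigma> * p (- x))" for x
  have Yc: "continuous_on {- l..l} Y" unfolding Y_def
    using par by (intro continuous_on_reflected sol_cont[OF y]) auto
  have Pc: "continuous_on {- l..l} P" unfolding P_def
    using par by (intro continuous_on_reflected sol_cont[OF y]) auto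
  have q: "(\<lambda>x. v x - E) \<in> borel_measurable lebesgue" using v_meas by measurable
  have qb: "\<bar>v x - E\<bar> \<le> M + \<bar>E\<bar>" for x using v_nonneg[of x] v_le[of x] by linarith
  define K where "K = N \<union> uminus ` N \<union> {0}"
  have K: "countable K" using N by (simp add: K_def)
  have der: "(Y has_real_derivative P x) (at x) \<and> (P has_real_derivative (v x - E) * Y x) (at x)"
    if x: "x \<in> {- l<..<l} - K" for x
  proof (cases "0 < x")
    case True
    then have x': "x \<in> {0<..<l} - N" using x by (auto simp: K_def)
    have "(Y has_real_derivative p x) (at x)"
      by (rule has_field_derivative_transform_within_open[of y _ _ "{0<..<l}"])
         (use sol_deriv[OF y, of x] x' in \<open>auto simp: Y_def\<close>)
    moreover have "(P has_real_derivative (v x - E) * y x) (at x)"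
      by (rule has_field_derivative_transform_within_open[of p _ _ "{0<..<l}"])
         (use sol_deriv2[OF y x'] x' in \<open>auto simp: P_def\<close>)
    ultimately show ?thesis using True by (simp add: Y_def P_def)
  next
    case False
    then have x': "x < 0" "- x \<in> {0<..<l} - N" using x by (auto simp: K_def image_iff)
    have "((\<lambda>x. y (- x)) has_real_derivative - p (- x)) (at x)"
      using DERIV_mirror[of y "p (- x)" x] sol_deriv[OF y, of "- x"] x' by auto
    then have 1: "((\<lambda>x. \<sigma> * y (- x)) has_real_derivative \<sigma> * - p (- x)) (at x)"
      by (rule DERIV_cmult)
    have "((\<lambda>x. p (- x)) has_real_derivative - ((v (- x) - E) * y (- x))) (at x)"
      using DERIV_mirror[of p "(v (- x) - E) * y (- x)" x] sol_deriv2[OF y x'(2)] by auto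
    then have 2: "((\<lambda>x. - \<sigma> * p (- x)) has_real_derivative - \<sigma> * - ((v (- x) - E) * y (- x))) (at x)"
      by (rule DERIV_cmult)
    have "(Y has_real_derivative \<sigma> * - p (- x)) (at x)"
      by (rule has_field_derivative_transform_within_open[OF 1, of "{- l<..<0}"])
         (use x' in \<open>auto simp: Y_def\<close>)
    moreover have "(P has_real_derivative - \<sigma> * - ((v (- x) - E) * y (- x))) (at x)"
      by (rule has_field_derivative_transform_within_open[OF 2, of "{- l<..<0}"])
         (use x' in \<open>auto simp: P_def\<close>)
    ultimately show ?thesis using x' by (simp add: Y_def P_def v_even mult_ac)
  qed
  have isCont_interior: "isCont h x" if "continuous_on {- l..l} h" "x \<in> {- l<..<l} - K"
    for h :: "real \<Rightarrow> real" and x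
    using that by (metis DiffD1 at_within_Icc_at continuous_on_eq_continuous_within
        greaterThanLessThan_iff atLeastAtMost_iff less_imp_le)
  have ext: "extend \<sigma> y x = complex_of_real (Y x)" if "x \<in> {- l..l}" for x
    using that yl l by (cases "x = l"; cases "x = - l") (auto simp: extend_def Y_def)
  have "has_ac_derivative_on (extend \<sigma> y) (\<lambda>x. of_real (P x)) (- l) l"
  proof (rule has_ac_derivative_onI[OF Yc _ K _ ext])
    show "P absolutely_integrable_on {- l..l}"
      using Pc by (metis absolutely_integrable_continuous box_real(2))
  qed (use der isCont_interior[OF Pc] in auto)
  moreover have "has_ac_derivative_on (\<lambda>x. of_real (P x)) (\<lambda>x. of_real ((v x - E) * Y x)) (- l) l"
  proof (rule has_ac_derivative_onI[OF Pc _ K _ refl])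
    show "(\<lambda>x. (v x - E) * Y x) absolutely_integrable_on {- l..l}"
      by (rule bounded_measurable_times_continuous_integrable[OF q qb Yc])
    fix x assume x: "x \<in> {- l<..<l} - K"
    then have "isCont v x" "isCont Y x" using v_cont[of x] isCont_interior[OF Yc x] by (auto simp: K_def)
    then show "(P has_real_derivative (v x - E) * Y x) (at x) \<and> isCont (\<lambda>x. (v x - E) * Y x) x"
      using der[OF x] by (auto intro!: continuous_intros)
  qed
  moreover have "square_integrable_on (\<lambda>x. of_real ((v x - E) * Y x)) {- l<..<l}"
    by (rule square_integrable_on_bounded_times_continuous[OF q qb Yc]) simp
  moreover have "square_integrable_on (\<lambda>x. of_real E * extend \<sigma> y x) {- l<..<l}"
    by (rule square_integrable_on_bounded_times_continuous[of "\<lambda>_. E" "\<bar>E\<bar>", OF _ _ Yc])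
       (use ext in auto)
  moreover have "AE x in lebesgue_on {- l<..<l}. of_real E * extend \<sigma> y x =
      - complex_of_real ((v x - E) * Y x) + of_real (v x) * extend \<sigma> y x"
    by (rule AE_I2) (auto simp: ext algebra_simps)
  moreover have "extend \<sigma> y x = 0" if "x \<notin> {- l<..<l}" for x
    using that by (auto simp: extend_def)
  ultimately show ?thesis
    unfolding eigenspace_def dirichlet_schroedinger_def mem_Collect_eq half
    by (intro conjI allI impI exI[of _ "\<lambda>x. complex_of_real (P x)"]
        exI[of _ "\<lambda>x. complex_of_real ((v x - E) * Y x)"])
qed

section \<open>Counting eigenvalues and the gap\<close>

lemma multiplicity_pos:
  fixes \<sigma> :: real
  assumes y: "sol E y p" and yl: "y l = 0" and par: "\<sigma> = 1 \<and> p 0 = 0 \<or> \<sigma> = - 1 \<and> y 0 = 0"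
    and pos: "\<And>x. x \<in> {0<..<l} \<Longrightarrow> 0 < y x"
  shows "0 < multiplicity_of v (2 * l) E"
proof -
  obtain c c' where c: "sol E c c'" "c 0 = 1" "c' 0 = 0" using sol_exists by blast
  obtain s s' where s: "sol E s s'" "s 0 = 0" "s' 0 = 1" using sol_exists by blast
  have "extend \<sigma> y (l / 2) \<noteq> 0" using pos[of "l / 2"] l by (simp add: extend_def)
  then have "extend \<sigma> y \<noteq> 0" by (metis zero_fun_apply)
  then show ?thesis
    unfolding multiplicity_of_def
    using cfun.dim_pos_if_finite_span[OF _ eigenspace_subset_span[OF c s] extend_in_eigenspace[OF y yl par]]
    by simp
qed

text \<open>Two one-sided bounds suffice: no eigenvalue lies below \<open>E0\<close>, and the
  distinct eigenvalues \<open>E0 < E1\<close> already count two up to \<open>E1\<close>.\<close>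

lemma spectral_gap_le: "spectral_gap v (2 * l) \<le> 3 * \<kappa>\<^sup>2"
proof -
  have start: "shoot_pos 1 0 0"
    unfolding shoot_pos_def by (intro ballI even_sol_zero_energy_pos[OF shoot]) simp
  have bound: "E \<le> M + \<kappa>\<^sup>2" if "shoot_pos 1 0 E" for E
    by (rule even_sol_pos_imp_energy_le[OF shoot(1) shoot(3)]) (rule that[unfolded shoot_pos_def, THEN bspec])
  obtain E0 where "0 < E0" "E0 \<le> M + \<kappa>\<^sup>2" and E0: "fst (shoot 1 0 E0) l = 0" "\<And>x. x \<in> {0<..<l} \<Longrightarrow> 0 < fst (shoot 1 0 E0) x"
    "\<And>E. E < E0 \<Longrightarrow> \<exists>E'>E. shoot_pos 1 0 E'"
    by (rule shooting[OF disjI1[OF zero_less_one] start]) (erule bound, iprover intro: that)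
  have upos: "0 < fst (shoot 1 0 E0) x" if "x \<in> {0..<l}" for x
    using E0(2)[of x] shoot(2)[of 1 0 E0] that by (cases "x = 0") auto
  have start': "shoot_pos 0 1 E0"
    unfolding shoot_pos_def
    by (intro ballI odd_sol_pos_at_ground_energy[OF shoot E0(1) upos shoot])
  have bound': "E \<le> E0 + 3 * \<kappa>\<^sup>2" if "shoot_pos 0 1 E" for E
    by (rule odd_sol_pos_imp_energy_le[OF shoot E0(1) _ shoot])
       (erule upos, erule that[unfolded shoot_pos_def, THEN bspec])
  obtain E1 where E1: "E0 < E1" "E1 \<le> E0 + 3 * \<kappa>\<^sup>2" "fst (shoot 0 1 E1) l = 0"
    "\<And>x. x \<in> {0<..<l} \<Longrightarrow> 0 < fst (shoot 0 1 E1) x"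
    and "\<And>E. E < E1 \<Longrightarrow> \<exists>E'>E. shoot_pos 0 1 E'"
    by (rule shooting[OF disjI2[OF conjI[OF refl zero_less_one]] start']) (erule bound', iprover intro: that)
  have m0: "0 < multiplicity_of v (2 * l) E0"
    by (rule multiplicity_pos[where \<sigma> = 1, OF shoot(1) E0(1)]) (simp add: shoot, erule E0(2))
  have m1: "0 < multiplicity_of v (2 * l) E1"
    by (rule multiplicity_pos[where \<sigma> = "- 1", OF shoot(1) E1(3)]) (simp add: shoot, erule E1(4))
  have ge: "E0 \<le> E" if "0 < multiplicity_of v (2 * l) E" for E
  proof (rule ccontr)
    assume "\<not> E0 \<le> E"
    then obtain E' where E': "E < E'" "shoot_pos 1 0 E'" using E0(3)[of E] by auto
    have "\<not> eigenspace v (2 * l) E \<subseteq> cfun.span {}"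
      using that cfun.dim_le_card[of "eigenspace v (2 * l) E" "{}"] by (auto simp: multiplicity_of_def)
    then obtain f where "f \<in> eigenspace v (2 * l) E" "f \<noteq> 0" by auto
    then show False using eigen_energy_ge_shoot[OF _ _ E'(2)] E'(1) by fastforce
  qed
  let ?S = "\<lambda>n::nat. {E. \<exists>F. finite F \<and> F \<subseteq> {..E} \<and> n < (\<Sum>\<mu>\<in>F. multiplicity_of v (2 * l) \<mu>)}"
  have lower: "E0 \<le> E" if E: "E \<in> ?S n" for E n
  proof -
    obtain F where F: "F \<subseteq> {..E}" "n < (\<Sum>\<mu>\<in>F. multiplicity_of v (2 * l) \<mu>)" using E by auto
    then have "(\<Sum>\<mu>\<in>F. multiplicity_of v (2 * l) \<mu>) \<noteq> 0" by linarith
    then obtain \<mu> where "\<mu> \<in> F" "multiplicity_of v (2 * l) \<mu> \<noteq> 0" by (rule sum.not_neutral_contains_not_neutral)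
    then show ?thesis using ge[of \<mu>] F by auto
  qed
  \<comment> \<open>Membership also shows that the set is nonempty, without which its
    \<open>Inf\<close> would carry no information.\<close>
  have "E0 \<in> ?S 0" using m0 by (auto intro!: exI[of _ "{E0}"])
  then have "E0 \<le> eigenvalue v (2 * l) 0"
    unfolding eigenvalue_def by (intro cInf_greatest) (use lower[where n = 0] in blast)+
  moreover have "E1 \<in> ?S 1" using m0 m1 E1(1) by (auto intro!: exI[of _ "{E0, E1}"])
  then have "eigenvalue v (2 * l) 1 \<le> E1"
    unfolding eigenvalue_def by (intro cInf_lower bdd_belowI[of _ E0] lower[where n = 1])
  ultimately show ?thesis using E1(2) by (simp add: spectral_gap_def)
qed

end

section \<open>Pointwise bounds and continuity of the potential, and the theorem\<close>

lemma bounded_off_zero_if_mono_even: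
  fixes v :: "real \<Rightarrow> real"
  assumes C: "AE x in lebesgue. \<bar>v x\<bar> \<le> C" and even: "\<And>x. v (- x) = v x"
    and mono: "mono_on {..<0} v" and "x \<noteq> 0"
  shows "v x \<le> C"
proof -
  have neg: "v x \<le> C" if "x < 0" for x
  proof (rule ccontr)
    assume "\<not> v x \<le> C"
    \<comment> \<open>Monotonicity carries a value above the essential bound to a whole interval,
      which is not a null set.\<close>
    have "{x<..<0} \<subseteq> {x. \<not> \<bar>v x\<bar> \<le> C}"
    proof
      fix y assume "y \<in> {x<..<0}"
      then have "v x \<le> v y" using that by (intro mono_onD[OF mono]) auto
      then show "y \<in> {x. \<not> \<bar>v x\<bar> \<le> C}" using \<open>\<not> v x \<le> C\<close> by auto
    qed
    moreover have "negligible {x. \<not> \<bar>v x\<bar> \<le> C}"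
      using C unfolding eventually_ae_filter_negligible by (metis negligible_subset)
    ultimately have "negligible {x<..<0}" by (rule negligible_subset[rotated])
    then show False using open_not_negligible[of "{x<..<0}"] that by auto
  qed
  show ?thesis using neg[of x] neg[of "- x"] even[of x] assms(4) by (cases "x < 0") auto
qed

lemma countable_discont_if_mono_even:
  fixes v :: "real \<Rightarrow> real"
  assumes even: "\<And>x. v (- x) = v x" and mono: "mono_on {..<0} v"
  shows "countable {x. \<not> isCont v x}"
proof -
  let ?A = "{x\<in>{..<0}. \<not> isCont v x}"
  have A: "countable ?A" using mono_on_ctble_discont_open[OF _ mono] by simp
  have refl: "\<not> isCont v (- x)" if "\<not> isCont v x" for x
    using that isCont_minus_even[of v "- x", OF even] by auto
  have "{x. \<not> isCont v x} \<subseteq> ?A \<union> uminus ` ?A \<union> {0}"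
  proof
    fix x assume x: "x \<in> {x. \<not> isCont v x}"
    consider "x < 0" | "x = 0" | "0 < x" by linarith
    then show "x \<in> ?A \<union> uminus ` ?A \<union> {0}"
    proof cases
      case 3
      then have "- x \<in> ?A" using refl x by auto
      then have "x \<in> uminus ` ?A" by (intro image_eqI[of _ _ "- x"]) simp_all
      then show ?thesis by blast
    qed (use x in auto)
  qed
  then show ?thesis by (rule countable_subset) (use A in auto)
qed

theorem theorem2p3:
  fixes v :: "real \<Rightarrow> real"
  assumes "v \<in> borel_measurable lebesgue"
    and "\<exists>C. AE x in lebesgue. \<bar>v x\<bar> \<le> C"
    and "\<forall>x. 0 \<le> v x"
    and "\<forall>x. v (- x) = v x"
    and "mono_on {..<0} v"
  shows "\<forall>L>0. spectral_gap v L \<le> 3 * pi\<^sup>2 / L\<^sup>2"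
proof (intro allI impI)
  fix L :: real assume L: "L > 0"
  obtain C where C: "AE x in lebesgue. \<bar>v x\<bar> \<le> C" using assms(2) by blast
  \<comment> \<open>The essential bound says nothing about the single value \<open>v 0\<close>, so
    the pointwise bound is the maximum of both.\<close>
  interpret symmetric_barrier v "L / 2" "{x. \<not> isCont v x}" "max C (v 0)"
  proof
    show "v x \<le> max C (v 0)" for x
      using bounded_off_zero_if_mono_even[OF C _ assms(5), of x] assms(4) by (cases "x = 0") auto
    show "v x' \<le> v x" if "0 < x" "x \<le> x'" for x x'
    proof -
      have "v (- x') \<le> v (- x)" using assms(5) that by (intro mono_onD[of "{..<0}" v]) auto
      then show ?thesis using assms(4) by simp
    qed
    show "countable {x. \<not> isCont v x}"
      using countable_discont_if_mono_even[OF _ assms(5)] assms(4) by blast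
  qed (use assms L in auto)
  show "spectral_gap v L \<le> 3 * pi\<^sup>2 / L\<^sup>2"
    using spectral_gap_le by (simp add: \<kappa>_def power_divide)
qed

end
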